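(* Let $G$ be a compact Lie group, $K$ a closed subgroup of $G$, and let $G/K$ be the corresponding compact homogeneous manifold with its normalized $G$-invariant measure $\mu$. Let $(\Phi,\Psi)$ be a normalized complementary pair of continuous Young functions such that (i) $\Phi \prec \Phi_0$, where $\Phi_0(t)=\frac12 t^2$; (ii) there are $p\ge 1$ and $c_0>0$ such that $\Psi'(t)\le c_0\,t^p$ for $t\ge 0$. Then there is a constant $r_0\ge 1$, independent of $f$, such that for every $f\in L^\Phi(G/K)$ $$N_\Psi(F_f)\le r_0\,N_\Phi(f).$$
   Context: **Fourier analysis on $G/K$.** $G$ is a compact Lie group, $K$ a closed subgroup, and $\mu$ is the unique $G$-invariant positive Radon measure on $G/K$ with $\mu(G/K)=1$. $\widehat G$ is the set of equivalence classes of irreducible continuous unitary representations of $G$; $d_\pi$ is the dimension of $\pi$, with representation space $\mathcal H_\pi$. $\widehat G_0\subset\widehat G$ is the set of class I representations with respect to $K$, i.e. those $\pi$ for which the space $B_\pi=\{a\in\mathcal H_\pi:\pi(h)a=a\ \forall h\in K\}$ is non-zero; $k_\pi=\dim B_\pi\ge 1$. For each $\pi\in\widehat G_0$ an orthonormal basis of $\mathcal H_\pi$ is fixed whose first $k_\pi$ vectors form a basis of $B_\pi$. For $f\in L^1(G/K)$, lifted to the right $K$-invariant function $\tilde f(g)=f(gK)$ on $G$, the Fourier coefficient is the matrix $\widehat f(\pi)=\int_G \tilde f(g)\,\pi(g)^*\,dg\in\mathbb C^{d_\pi\times d_\pi}$ ($dg$ normalized Haar measure), so that formally $f(x)=\sum_{\pi\in\widehat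 G_0}d_\pi\,\mathrm{Tr}(\widehat f(\pi)\pi(x))$; the rows of $\widehat f(\pi)$ of index greater than $k_\pi$ vanish. Define $F_f:\widehat G_0\to[0,\infty)$ by $$F_f(\pi)=\left(\frac{\mathrm{Tr}(\widehat f(\pi)^*\widehat f(\pi))}{k_\pi}\right)^{1/2}=k_\pi^{-1/2}\|\widehat f(\pi)\|_{HS}.$$ **Young functions.** A Young function is a non-zero convex function $\Phi:[0,\infty)\to[0,\infty]$ with $\Phi(0)=0$ and $\lim_{x\to\infty}\Phi(x)=\infty$. Its complementary function is $\Psi(y)=\sup\{xy-\Phi(x):x\ge 0\}$, $y\ge 0$, again a Young function, and $(\Phi,\Psi)$ is called a complementary pair. It is normalized if $\Phi(1)+\Psi(1)=1$. $\Psi'$ denotes the derivative of $\Psi$ (a bound on $\Psi'$ is understood at the points where $\Psi$ is differentiable). **Ordering.** For Young functions, $\Phi_1\prec\Phi_2$ means that there are fixed positive constants $a,b,c,d,x_0,x_1$ such that $\Phi_1(ax)\le b\,\Phi_2(x)$ for all $x\ge x_0$ and $\Phi_2(cx)\le d\,\Phi_1(x)$ for all $0\le x\le x_1$. **Orlicz spaces and norms.** $L^\Phi(G/K)$ is the space of (classes of a.e. equal) complex-valued measurable functions $f$ on $G/K$ with $\int_{G/K}\Phi(a|f|)\,d\mu<\infty$ for some $a>0$, with norm $$N_\Phi(f)=\inf\Big\{\lambda>0:\int_{G/K}\Phi\big(|f|/\lambda\big)\,d\mu\le\Phi(1)\Big\}.$$ It is contained in $L^1(G/K)$. For $F:\widehat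 G_0\to[0,\infty)$, $$N_\Psi(F)=\inf\Big\{\lambda>0:\sum_{\pi\in\widehat G_0}\Psi\big(F(\pi)/\lambda\big)\,k_\pi d_\pi\le\Psi(1)\Big\}.$$ *)

theory Defs
  imports
    "HOL-Analysis.Analysis"
    "HOL-Algebra.Left_Coset"
    "Jordan_Normal_Form.Schur_Decomposition"
    "Jordan_Normal_Form.VS_Connect"
begin

section \<open>Lie groups\<close>

text \<open>
  For open \<open>S\<close> in a finite-dimensional space, \<open>Ck_on n S f\<close> is the usual \<open>C\<^sup>n\<close> condition,
  phrased through iterated directional derivatives.
\<close>

primrec Ck_on ::
  "nat \<Rightarrow> 'a::real_normed_vector set \<Rightarrow> ('a \<Rightarrow> 'b::real_normed_vector) \<Rightarrow> bool" where
  "Ck_on 0 S f \<longleftrightarrow> continuous_on S f"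
| "Ck_on (Suc n) S f \<longleftrightarrow>
     (\<forall>x\<in>S. f differentiable (at x)) \<and>
     (\<forall>v. Ck_on n S (\<lambda>x. frechet_derivative f (at x) v))"

definition smooth_on ::
  "'a::real_normed_vector set \<Rightarrow> ('a \<Rightarrow> 'b::real_normed_vector) \<Rightarrow> bool" where
  "smooth_on S f \<longleftrightarrow> (\<forall>n. Ck_on n S f)"

text \<open>
  The underlying space of the group is \<open>carrier G\<close> with the subspace topology. Charts are pairs
  \<open>(U, \<phi>)\<close> with values in a finite-dimensional real normed space \<open>'e\<close>. The class
  \<open>euclidean_space\<close> would exclude dimension 0, that is, the finite groups.
\<close>

definition smooth_atlas ::
  "'g::topological_space set \<Rightarrow> ('g set \<times> ('g \<Rightarrow> 'e::real_normed_vector)) set \<Rightarrow> bool" where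
  "smooth_atlas M \<A> \<longleftrightarrow>
     (\<exists>B::'e set. finite B \<and> Real_Vector_Spaces.span B = UNIV) \<and>
     (\<forall>(U, \<phi>)\<in>\<A>. openin (top_of_set M) U \<and> open (\<phi> ` U) \<and>
        homeomorphism U (\<phi> ` U) \<phi> (inv_into U \<phi>)) \<and>
     (\<Union>(U, \<phi>)\<in>\<A>. U) = M \<and>
     (\<forall>(U, \<phi>)\<in>\<A>. \<forall>(V, \<psi>)\<in>\<A>. smooth_on (\<phi> ` (U \<inter> V)) (\<psi> \<circ> inv_into U \<phi>))"

definition lie_group ::
  "'g::{second_countable_topology,t2_space} monoid \<Rightarrow>
   ('g set \<times> ('g \<Rightarrow> 'e::real_normed_vector)) set \<Rightarrow> bool" where
  "lie_group G \<A> \<longleftrightarrow>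
     group G \<and> smooth_atlas (carrier G) \<A> \<and>
     continuous_on (carrier G \<times> carrier G) (\<lambda>(x, y). x \<otimes>\<^bsub>G\<^esub> y) \<and>
     continuous_on (carrier G) (\<lambda>x. inv\<^bsub>G\<^esub> x) \<and>
     (\<forall>(U, \<phi>)\<in>\<A>. \<forall>(V, \<psi>)\<in>\<A>. \<forall>(W, \<theta>)\<in>\<A>.
        smooth_on {(u, v). u \<in> \<phi> ` U \<and> v \<in> \<psi> ` V \<and> inv_into U \<phi> u \<otimes>\<^bsub>G\<^esub> inv_into V \<psi> v \<in> W}
          (\<lambda>(u, v). \<theta> (inv_into U \<phi> u \<otimes>\<^bsub>G\<^esub> inv_into V \<psi> v))) \<and>
     (\<forall>(U, \<phi>)\<in>\<A>. \<forall>(V, \<psi>)\<in>\<A>.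
        smooth_on {u. u \<in> \<phi> ` U \<and> inv\<^bsub>G\<^esub> (inv_into U \<phi> u) \<in> V}
          (\<lambda>u. \<psi> (inv\<^bsub>G\<^esub> (inv_into U \<phi> u))))"


section \<open>Invariant measures on \<open>G\<close> and on \<open>G/K\<close>\<close>

definition radon_measure_on :: "'x topology \<Rightarrow> 'x measure \<Rightarrow> bool" where
  "radon_measure_on T M \<longleftrightarrow>
     space M = topspace T \<and>
     sets M = sigma_sets (topspace T) {U. openin T U} \<and>
     (\<forall>C. compactin T C \<longrightarrow> emeasure M C < \<infinity>) \<and>
     (\<forall>A\<in>sets M. emeasure M A = (INF U\<in>{U. openin T U \<and> A \<subseteq> U}. emeasure M U)) \<and>
     (\<forall>U. openin T U \<longrightarrow> emeasure M U = (SUP C\<in>{C. compactin T C \<and> C \<subseteq> U}. emeasure M C))"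

definition normalized_haar :: "'g::topological_space monoid \<Rightarrow> 'g measure \<Rightarrow> bool" where
  "normalized_haar G h \<longleftrightarrow>
     radon_measure_on (top_of_set (carrier G)) h \<and> emeasure h (space h) = 1 \<and>
     (\<forall>g\<in>carrier G. \<forall>A\<in>sets h. emeasure h (g <#\<^bsub>G\<^esub> A) = emeasure h A)"

text \<open>\<open>G/K\<close> is the set of left cosets of \<open>K\<close>, with the quotient topology of \<open>g \<mapsto> gK\<close>.\<close>

definition coset_topology :: "'g::topological_space monoid \<Rightarrow> 'g set \<Rightarrow> 'g set topology" where
  "coset_topology G K =
     topology (\<lambda>U. U \<subseteq> lcosets\<^bsub>G\<^esub> K \<and>
       openin (top_of_set (carrier G)) {g \<in> carrier G. g <#\<^bsub>G\<^esub> K \<in> U})"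

lemma openin_coset_topology:
  "openin (coset_topology G K) U \<longleftrightarrow>
     U \<subseteq> lcosets\<^bsub>G\<^esub> K \<and> openin (top_of_set (carrier G)) {g \<in> carrier G. g <#\<^bsub>G\<^esub> K \<in> U}"
proof -
  let ?pre = "\<lambda>U. {g \<in> carrier G. g <#\<^bsub>G\<^esub> K \<in> U}"
  let ?P = "\<lambda>U. U \<subseteq> lcosets\<^bsub>G\<^esub> K \<and> openin (top_of_set (carrier G)) (?pre U)"
  have "?P (S \<inter> T)" if "?P S" "?P T" for S T
  proof -
    have "?pre (S \<inter> T) = ?pre S \<inter> ?pre T" by auto
    then show ?thesis using that by auto
  qed
  moreover have "?P (\<Union>\<K>)" if "\<forall>S\<in>\<K>. ?P S" for \<K>
  proof -
    have "?pre (\<Union>\<K>) = (\<Union>S\<in>\<K>. ?pre S)" by auto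
    moreover have "openin (top_of_set (carrier G)) (\<Union>S\<in>\<K>. ?pre S)"
      using that by (intro openin_Union) auto
    ultimately show ?thesis using that by auto
  qed
  ultimately have "istopology ?P" unfolding istopology_def by blast
  then show ?thesis unfolding coset_topology_def by (simp add: topology_inverse')
qed

lemma topspace_coset_topology: "topspace (coset_topology G K) = lcosets\<^bsub>G\<^esub> K"
proof -
  have "{g \<in> carrier G. g <#\<^bsub>G\<^esub> K \<in> lcosets\<^bsub>G\<^esub> K} = carrier G"
    by (auto simp: LCOSETS_def)
  then have "openin (coset_topology G K) (lcosets\<^bsub>G\<^esub> K)"
    by (simp add: openin_coset_topology)
  then show ?thesis
    by (metis openin_coset_topology openin_subset openin_topspace subset_antisym)
qed

definition invariant_prob_measure ::
  "'g::topological_space monoid \<Rightarrow> 'g set \<Rightarrow> 'g set measure \<Rightarrow> bool" where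
  "invariant_prob_measure G K \<mu> \<longleftrightarrow>
     radon_measure_on (coset_topology G K) \<mu> \<and> emeasure \<mu> (space \<mu>) = 1 \<and>
     (\<forall>g\<in>carrier G. \<forall>A\<in>sets \<mu>. emeasure \<mu> ((\<lambda>x. g <#\<^bsub>G\<^esub> x) ` A) = emeasure \<mu> A)"


section \<open>The unitary dual and class I representations\<close>

text \<open>
  Irreducible unitary representations of a compact group are finite-dimensional, so a
  representation together with an orthonormal basis of its space is a pair \<open>(d, \<rho>)\<close> of the
  dimension and a function with values in the unitary \<open>d \<times> d\<close> matrices. Values of \<open>\<rho>\<close> outside
  \<open>carrier G\<close> are irrelevant.
\<close>

type_synonym 'g matrix_rep = "nat \<times> ('g \<Rightarrow> complex mat)"

definition unitary_mat :: "nat \<Rightarrow> complex mat \<Rightarrow> bool" where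
  "unitary_mat d U \<longleftrightarrow> U \<in> carrier_mat d d \<and> U * mat_adjoint U = 1\<^sub>m d"

definition unitary_rep :: "'g::topological_space monoid \<Rightarrow> 'g matrix_rep \<Rightarrow> bool" where
  "unitary_rep G = (\<lambda>(d, \<rho>).
     (\<forall>g\<in>carrier G. unitary_mat d (\<rho> g)) \<and>
     (\<forall>g\<in>carrier G. \<forall>h\<in>carrier G. \<rho> (g \<otimes>\<^bsub>G\<^esub> h) = \<rho> g * \<rho> h) \<and>
     (\<forall>i<d. \<forall>j<d. continuous_on (carrier G) (\<lambda>g. \<rho> g $$ (i, j))))"

definition irreducible_rep :: "'g::topological_space monoid \<Rightarrow> 'g matrix_rep \<Rightarrow> bool" where
  "irreducible_rep G = (\<lambda>(d, \<rho>).
     d > 0 \<and>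
     (\<forall>W. VectorSpace.subspace class_ring W (module_vec TYPE(complex) d) \<and>
          (\<forall>g\<in>carrier G. \<forall>w\<in>W. \<rho> g *\<^sub>v w \<in> W) \<longrightarrow>
          W = {0\<^sub>v d} \<or> W = carrier_vec d))"

definition unitary_irreps :: "'g::topological_space monoid \<Rightarrow> 'g matrix_rep set" where
  "unitary_irreps G = {R. unitary_rep G R \<and> irreducible_rep G R}"

definition unitary_equiv :: "'g::topological_space monoid \<Rightarrow> ('g matrix_rep \<times> 'g matrix_rep) set" where
  "unitary_equiv G =
     {(R, S). R \<in> unitary_irreps G \<and> S \<in> unitary_irreps G \<and> fst R = fst S \<and>
        (\<exists>U. unitary_mat (fst R) U \<and> (\<forall>g\<in>carrier G. U * snd R g = snd S g * U))}"

definition unitary_dual :: "'g::topological_space monoid \<Rightarrow> 'g matrix_rep set set" where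
  "unitary_dual G = unitary_irreps G // unitary_equiv G"

definition fixed_vectors :: "'g set \<Rightarrow> 'g matrix_rep \<Rightarrow> complex vec set" where
  "fixed_vectors K = (\<lambda>(d, \<rho>). {a \<in> carrier_vec d. \<forall>h\<in>K. \<rho> h *\<^sub>v a = a})"

definition fixed_space :: "'g set \<Rightarrow> 'g matrix_rep \<Rightarrow> (complex, complex vec) module" where
  "fixed_space K R = (module_vec TYPE(complex) (fst R))\<lparr>carrier := fixed_vectors K R\<rparr>"

definition fixed_dim :: "'g set \<Rightarrow> 'g matrix_rep \<Rightarrow> nat" where
  "fixed_dim K R = vectorspace.dim class_ring (fixed_space K R)"

definition class_I_dual :: "'g::topological_space monoid \<Rightarrow> 'g set \<Rightarrow> 'g matrix_rep set set" where
  "class_I_dual G K = {\<pi> \<in> unitary_dual G. \<exists>R\<in>\<pi>. fixed_vectors K R \<noteq> {0\<^sub>v (fst R)}}"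

text \<open>
  Fixing an orthonormal basis of the space of each class I representation \<open>\<pi>\<close> amounts to
  selecting a matrix representation \<open>b \<pi>\<close> in the class \<open>\<pi>\<close>; the chosen basis becomes the
  standard basis.
\<close>

definition adapted_bases ::
  "'g::topological_space monoid \<Rightarrow> 'g set \<Rightarrow> ('g matrix_rep set \<Rightarrow> 'g matrix_rep) \<Rightarrow> bool" where
  "adapted_bases G K b \<longleftrightarrow>
     (\<forall>\<pi>\<in>class_I_dual G K. b \<pi> \<in> \<pi> \<and>
        vectorspace.basis class_ring (fixed_space K (b \<pi>))
          (unit_vec (fst (b \<pi>)) ` {..<fixed_dim K (b \<pi>)}))"


section \<open>Fourier coefficients\<close>

definition fourier_coeff ::
  "'g monoid \<Rightarrow> 'g set \<Rightarrow> 'g measure \<Rightarrow> ('g set \<Rightarrow> complex) \<Rightarrow> 'g matrix_rep \<Rightarrow> complex mat" where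
  "fourier_coeff G K h f = (\<lambda>(d, \<rho>).
     mat d d (\<lambda>(i, j). \<integral>g. f (g <#\<^bsub>G\<^esub> K) * mat_adjoint (\<rho> g) $$ (i, j) \<partial>h))"

definition mat_trace :: "complex mat \<Rightarrow> complex" where
  "mat_trace A = (\<Sum>i<dim_row A. A $$ (i, i))"

definition fourier_size ::
  "'g monoid \<Rightarrow> 'g set \<Rightarrow> 'g measure \<Rightarrow> ('g set \<Rightarrow> complex) \<Rightarrow> 'g matrix_rep \<Rightarrow> real" where
  "fourier_size G K h f R =
     sqrt (Re (mat_trace (mat_adjoint (fourier_coeff G K h f R) * fourier_coeff G K h f R))
           / real (fixed_dim K R))"


section \<open>Young functions and Orlicz spaces\<close>

text \<open>Young functions are represented on all of \<open>\<real>\<close>; only arguments \<open>\<ge> 0\<close> are relevant.\<close>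

definition young_function :: "(real \<Rightarrow> ennreal) \<Rightarrow> bool" where
  "young_function \<Phi> \<longleftrightarrow>
     (\<exists>x\<ge>0. \<Phi> x \<noteq> 0) \<and> \<Phi> 0 = 0 \<and>
     (\<forall>x\<ge>0. \<forall>y\<ge>0. \<forall>u\<in>{0..1}.
        \<Phi> (u * x + (1 - u) * y) \<le> ennreal u * \<Phi> x + ennreal (1 - u) * \<Phi> y) \<and>
     (\<Phi> \<longlongrightarrow> \<infinity>) at_top"

definition complementary_pair :: "(real \<Rightarrow> ennreal) \<Rightarrow> (real \<Rightarrow> ennreal) \<Rightarrow> bool" where
  "complementary_pair \<Phi> \<Psi> \<longleftrightarrow>
     young_function \<Phi> \<and> young_function \<Psi> \<and>
     (\<forall>y\<ge>0. enn2ereal (\<Psi> y) = (SUP x\<in>{0..}. ereal (x * y) - enn2ereal (\<Phi> x)))"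

definition young_prec :: "(real \<Rightarrow> ennreal) \<Rightarrow> (real \<Rightarrow> ennreal) \<Rightarrow> bool"  (infix \<open>\<prec>\<^sub>Y\<close> 50) where
  "\<Phi>\<^sub>1 \<prec>\<^sub>Y \<Phi>\<^sub>2 \<longleftrightarrow>
     (\<exists>a b c d x\<^sub>0 x\<^sub>1 :: real. a > 0 \<and> b > 0 \<and> c > 0 \<and> d > 0 \<and> x\<^sub>0 > 0 \<and> x\<^sub>1 > 0 \<and>
        (\<forall>x\<ge>x\<^sub>0. \<Phi>\<^sub>1 (a * x) \<le> ennreal b * \<Phi>\<^sub>2 x) \<and>
        (\<forall>x\<in>{0..x\<^sub>1}. \<Phi>\<^sub>2 (c * x) \<le> ennreal d * \<Phi>\<^sub>1 x))"

text \<open>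
  \<open>\<Psi>' \<le> \<beta>\<close> wherever \<open>\<Psi>\<close> is finite and differentiable (from the right at 0). If \<open>\<Psi>\<close> jumps
  to infinity at \<open>t\<close>, \<open>enn2real\<close> replaces the infinite values by 0; a derivative at \<open>t\<close> can then
  exist only with \<open>\<Psi> t = 0\<close> and \<open>D = 0\<close>, which is harmless for \<open>\<beta> \<ge> 0\<close>.
\<close>

definition deriv_bounded_by :: "(real \<Rightarrow> ennreal) \<Rightarrow> (real \<Rightarrow> real) \<Rightarrow> bool" where
  "deriv_bounded_by \<Psi> \<beta> \<longleftrightarrow>
     (\<forall>t\<ge>0. \<forall>D. \<Psi> t < \<infinity> \<and>
        ((\<lambda>s. enn2real (\<Psi> s)) has_real_derivative D) (at t within {0..}) \<longrightarrow> D \<le> \<beta> t)"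

definition orlicz_space :: "(real \<Rightarrow> ennreal) \<Rightarrow> 'x measure \<Rightarrow> ('x \<Rightarrow> complex) set" where
  "orlicz_space \<Phi> \<mu> =
     {f \<in> borel_measurable \<mu>. \<exists>a>0. (\<integral>\<^sup>+x. \<Phi> (a * norm (f x)) \<partial>\<mu>) < \<infinity>}"

text \<open>The norms are \<open>ennreal\<close>-valued, so that the infimum of the empty set is infinity.\<close>

definition orlicz_norm :: "(real \<Rightarrow> ennreal) \<Rightarrow> 'x measure \<Rightarrow> ('x \<Rightarrow> complex) \<Rightarrow> ennreal" where
  "orlicz_norm \<Phi> \<mu> f =
     (INF s\<in>{s::real. s > 0 \<and> (\<integral>\<^sup>+x. \<Phi> (norm (f x) / s) \<partial>\<mu>) \<le> \<Phi> 1}. ennreal s)"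

definition dual_orlicz_norm ::
  "'g::topological_space monoid \<Rightarrow> 'g set \<Rightarrow> ('g matrix_rep set \<Rightarrow> 'g matrix_rep) \<Rightarrow>
   (real \<Rightarrow> ennreal) \<Rightarrow> ('g matrix_rep set \<Rightarrow> real) \<Rightarrow> ennreal" where
  "dual_orlicz_norm G K b \<Psi> F =
     (INF s\<in>{s::real. s > 0 \<and>
          (\<Sum>\<^sub>\<infinity>\<pi>\<in>class_I_dual G K.
             \<Psi> (F \<pi> / s) * of_nat (fixed_dim K (b \<pi>) * fst (b \<pi>))) \<le> \<Psi> 1}. ennreal s)"

end

theory Submission
  imports Defs
begin

text \<open>The bound on the derivative of \<open>\<Psi>\<close> speaks only of points of
  differentiability, and \<open>\<Psi>\<close> might reach infinity. The growth estimate therefore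
  needs such a point near every t, and continuity to exclude a blow-up. Since r_0 may be any
  constant, real interpolation is enough: it asks only for subadditivity of f -> F_f(\<pi>) and for
  truncations of f. The price is a constant that explodes as p tends to 1, so p = 1, where q = 2, is
  treated by Bessel's inequality directly. The factor k^(-1/2) in F_f serves both endpoints. It
  turns k rows of norm at most the L^1 norm of f into a bound with constant 1, and it reduces the
  weight k d to the weight d of Schur orthogonality. Normalization gives
  \<open>\<Phi> 1 \<le> 1\<close>. Hence every scale s admissible in the norm of f yields a bound D
  for the integral of |f/s|^(q'), with D depending only on p and c_0. All estimates are made for
  f/s, so inhomogeneous bounds such as 1 + D are harmless. \<open>normalized_haar\<close> provides
  left invariance only, whereas the fixed columns rest on right translation by K; right invariance
  is derived by Fubini.\<close>

text \<open>
  The bound on \<open>\<Psi>'\<close> gives \<open>\<Psi>(t) \<le> C t\<^sup>q\<close> with \<open>q = p + 1 \<ge> 2\<close>, hence by Young's inequality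
  \<open>\<Phi>(x) \<ge> c x\<^bsup>q'\<^esup>\<close> for the conjugate exponent \<open>q' = 1 + 1/p\<close>. It therefore suffices to bound the
  weighted \<open>\<ell>\<^sup>q\<close> norm of \<open>F\<^sub>f\<close> by the \<open>L\<^bsup>q'\<^esup>\<close> norm of \<open>f\<close>, the Hausdorff-Young inequality. It follows
  by Marcinkiewicz interpolation between Bessel's inequality (Schur orthogonality of the matrix
  coefficients) and \<open>F\<^sub>f \<le> \<parallel>f\<parallel>\<^sub>1\<close>; the latter uses that the columns of the coefficient matrix are
  \<open>K\<close>-fixed, so that only \<open>k\<^sub>\<pi>\<close> of its rows are non-zero. If \<open>\<Psi>(1) = 0\<close>, the conclusion is a
  supremum bound, and \<open>F\<^sub>f \<le> \<parallel>f\<parallel>\<^sub>1\<close> alone gives it.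
\<close>

section \<open>Young functions of power growth\<close>

text \<open>The right derivative \<open>g\<close> is monotone and obeys the derivative bound
  wherever the function is differentiable. So g(t) \<le> g(s) \<le> c s^p for such a point s to the
  right of t, and the supporting line at t, evaluated at 0, shows that the increment from 0 to t is
  at most t g(t).\<close>

lemma convex_on_deriv_powr_bound:
  fixes \<psi> :: "real \<Rightarrow> real"
  assumes conv: "convex_on {0..T} \<psi>" and p: "p \<ge> 0"
    and deriv: "\<And>t D. 0 < t \<Longrightarrow> t < T \<Longrightarrow> (\<psi> has_real_derivative D) (at t) \<Longrightarrow> D \<le> c * t powr p"
    and c: "c \<ge> 0" and t: "0 < t" "t < T"
  shows "\<psi> t - \<psi> 0 \<le> c * 2 powr p * t powr (p + 1)"
proof -
  \<comment> \<open>The infimum of the slopes to the right of x is the right derivative of a convex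
    function, hence a subgradient at interior points.\<close>
  define g where "g x = Inf ((\<lambda>u. (\<psi> x - \<psi> u) / (x - u)) ` ({x<..} \<inter> {0..T}))" for x
  have sub: "\<psi> y \<ge> \<psi> x + g x * (y - x)" if "0 < x" "x < T" "y \<in> {0..T}" for x y
    using convex_le_Inf_differential[OF conv _ that(3), of x] that by (simp add: g_def)
  have gmono: "mono_on {0<..<T} g"
  proof (rule mono_onI)
    fix x y assume xy: "x \<in> {0<..<T}" "y \<in> {0<..<T}" "x \<le> y"
    show "g x \<le> g y"
    proof (cases "x = y")
      case False
      have "\<psi> y \<ge> \<psi> x + g x * (y - x)" "\<psi> x \<ge> \<psi> y + g y * (x - y)"
        using xy by (auto intro!: sub)
      then have "g x * (y - x) \<le> g y * (y - x)" by (simp add: algebra_simps)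
      with False xy show ?thesis by simp
    qed simp
  qed
  \<comment> \<open>A monotone function has only countably many discontinuities, so some continuity
    point s of \<open>g\<close> lies in this interval. The bound s < 2 t is the origin of the factor
    \<open>2 powr p\<close>.\<close>
  define t2 where "t2 = min (2 * t) T"
  have "countable {a \<in> {0<..<T}. \<not> isCont g a}"
    by (intro mono_on_ctble_discont_open gmono) auto
  moreover have "uncountable {t<..<t2}"
    using t by (simp add: t2_def uncountable_open_interval)
  ultimately have "\<not> {t<..<t2} \<subseteq> {a \<in> {0<..<T}. \<not> isCont g a}"
    using countable_subset by blast
  then obtain s where s: "t < s" "s < 2 * t" "s < T" and cont: "isCont g s"
    using t by (auto simp: t2_def)
  \<comment> \<open>The two subgradient inequalities, at s and at y, trap the difference quotient
    between g(s) and g(y), and \<open>g\<close> is continuous at s.\<close>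
  have "(\<psi> has_real_derivative g s) (at s)"
    unfolding has_field_derivative_iff
  proof (rule tendstoI)
    fix e :: real assume e: "e > 0"
    have "\<forall>\<^sub>F y in at s. dist (g y) (g s) < e"
      using cont e by (simp add: isCont_def tendsto_iff)
    moreover have "\<forall>\<^sub>F y in at s. y \<in> {0<..<T}"
      using s t by (intro eventually_at_in_open') auto
    moreover have "\<forall>\<^sub>F y in at s. y \<noteq> s"
      by (simp add: eventually_at_filter)
    ultimately show "\<forall>\<^sub>F y in at s. dist ((\<psi> y - \<psi> s) / (y - s)) (g s) < e"
    proof eventually_elim
      case (elim y)
      have 1: "\<psi> y - \<psi> s \<ge> g s * (y - s)" and 2: "\<psi> y - \<psi> s \<le> g y * (y - s)"
        using sub[of s y] sub[of y s] s t elim by (auto simp: algebra_simps)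
      have "\<bar>(\<psi> y - \<psi> s) / (y - s) - g s\<bar> \<le> \<bar>g y - g s\<bar>"
      proof (cases "y > s")
        case True
        then have "(\<psi> y - \<psi> s) / (y - s) \<ge> g s" "(\<psi> y - \<psi> s) / (y - s) \<le> g y"
          using 1 2 by (auto simp: field_simps)
        then show ?thesis by linarith
      next
        case False
        then have "(\<psi> y - \<psi> s) / (y - s) \<le> g s" "(\<psi> y - \<psi> s) / (y - s) \<ge> g y"
          using 1 2 elim by (auto simp: divide_le_eq le_divide_eq)
        then show ?thesis by linarith
      qed
      then show ?case using elim by (simp add: dist_real_def)
    qed
  qed
  then have "g s \<le> c * s powr p" using deriv[of s] s t by auto
  also have "\<dots> \<le> c * (2 * t) powr p"
    using c p s t by (intro mult_left_mono powr_mono2) auto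
  finally have gs: "g s \<le> c * 2 powr p * t powr p" using t by (simp add: powr_mult)
  have "\<psi> 0 \<ge> \<psi> t + g t * (0 - t)" using t by (intro sub) auto
  then have "\<psi> t - \<psi> 0 \<le> g t * t" by simp
  also have "g t \<le> g s" using gmono s t by (auto simp: mono_on_def)
  then have "g t * t \<le> (c * 2 powr p * t powr p) * t"
    using gs t by (intro mult_right_mono) auto
  finally show ?thesis using t by (simp add: powr_add)
qed

lemma young_function_mono:
  assumes Y: "young_function \<Psi>" and "0 \<le> x" "x \<le> y"
  shows "\<Psi> x \<le> \<Psi> y"
proof (cases "y = 0")
  case False
  then have y: "y > 0" using assms by simp
  have "\<Psi> ((x / y) * y + (1 - x / y) * 0) \<le> ennreal (x / y) * \<Psi> y + ennreal (1 - x / y) * \<Psi> 0"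
    using assms y by (intro Y[unfolded young_function_def, THEN conjunct2, THEN conjunct2, THEN conjunct1, rule_format]) auto
  also have "\<dots> = ennreal (x / y) * \<Psi> y" using Y by (simp add: young_function_def)
  also have "\<dots> \<le> 1 * \<Psi> y"
    using assms y by (intro mult_right_mono) (auto simp flip: ennreal_1 intro!: ennreal_leI)
  finally show ?thesis using y by simp
qed (use assms in auto)

text \<open>To the left of a point T with finite value, \<open>\<Psi>\<close> is a real convex
  function and the previous lemma applies. Continuity then excludes a first violation of the bound
  at or beyond the edge of the finite region.\<close>

lemma young_function_le_powr:
  assumes Y: "young_function \<Psi>" and cont: "continuous_on {0..} \<Psi>"
    and p: "p \<ge> 0" and c: "c \<ge> 0" and D: "deriv_bounded_by \<Psi> (\<lambda>t. c * t powr p)" and "t \<ge> 0"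
  shows "\<Psi> t \<le> ennreal (c * 2 powr p * t powr (p + 1))"
proof -
  have cvx: "\<Psi> (u * x + (1 - u) * y) \<le> ennreal u * \<Psi> x + ennreal (1 - u) * \<Psi> y"
    if "x \<ge> 0" "y \<ge> 0" "0 \<le> u" "u \<le> 1" for x y u
    using Y that unfolding young_function_def by auto
  have \<Psi>0: "\<Psi> 0 = 0" using Y by (simp add: young_function_def)
  have fin: "\<Psi> t \<le> ennreal (c * 2 powr p * t powr (p + 1))"
    if t: "0 \<le> t" "t < T" and T: "\<Psi> T < \<infinity>" for t T
  proof (cases "t = 0")
    case False
    define \<psi> where "\<psi> t = enn2real (\<Psi> t)" for t
    have \<psi>_nonneg: "\<psi> s \<ge> 0" for s by (simp add: \<psi>_def)
    have below: "\<Psi> s = ennreal (\<psi> s)" "\<Psi> s < \<infinity>" if "0 \<le> s" "s \<le> T" for s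
      using young_function_mono[OF Y that] T by (auto simp: \<psi>_def)
    have conv: "convex_on {0..T} \<psi>"
    proof (intro convex_onI)
      fix u x y :: real assume u: "0 < u" "u < 1" and xy: "x \<in> {0..T}" "y \<in> {0..T}"
      let ?z = "(1 - u) * x + u * y"
      have "?z \<in> {0..T}"
        using xy u convex_bound_le[of x T y "1 - u" u] by auto
      then have "ennreal (\<psi> ?z) = \<Psi> ?z" using below(1)[of ?z] by simp
      also have "\<dots> \<le> ennreal (1 - u) * \<Psi> x + ennreal u * \<Psi> y"
        using cvx[of x y "1 - u"] xy u by simp
      also have "\<dots> = ennreal ((1 - u) * \<psi> x + u * \<psi> y)"
      proof -
        have "\<Psi> x = ennreal (\<psi> x)" "\<Psi> y = ennreal (\<psi> y)" "\<psi> x \<ge> 0" "\<psi> y \<ge> 0"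
          using below(1)[of x] below(1)[of y] xy \<psi>_nonneg by simp_all
        then show ?thesis using u by (simp add: ennreal_mult ennreal_plus)
      qed
      finally show "\<psi> ((1 - u) *\<^sub>R x + u *\<^sub>R y) \<le> (1 - u) * \<psi> x + u * \<psi> y"
        using u xy by (subst (asm) ennreal_le_iff) (auto simp: \<psi>_nonneg)
    qed auto
    have "\<psi> t - \<psi> 0 \<le> c * 2 powr p * t powr (p + 1)"
    proof (rule convex_on_deriv_powr_bound[OF conv p _ c])
      fix s E assume s: "0 < s" "s < T" and deriv: "(\<psi> has_real_derivative E) (at s)"
      from has_field_derivative_at_within[OF deriv] have "((\<lambda>s. enn2real (\<Psi> s)) has_real_derivative E) (at s within {0..})"
        by (simp add: \<psi>_def[abs_def])
      then show "E \<le> c * s powr p"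
        using D[unfolded deriv_bounded_by_def, rule_format, of s E] s below(2)[of s] by simp
    qed (use t False in auto)
    moreover have "\<psi> 0 = 0" by (simp add: \<psi>_def \<Psi>0)
    ultimately show ?thesis using below(1)[of t] t by (simp add: ennreal_leI)
  qed (use \<Psi>0 in auto)
  show ?thesis
  proof (rule ccontr)
    define B where "B = c * 2 powr p * t powr (p + 1)"
    assume "\<not> ?thesis"
    then have lt: "ennreal B < \<Psi> t" by (simp add: B_def)
    \<comment> \<open>Two intermediate values are taken because the finite case at x needs a point
      with finite value strictly to its right. The intermediate value theorem realizes m at x and m'
      at some x' > x, and the bound at x contradicts \<open>ennreal B < m\<close>.\<close>
    obtain m where m: "ennreal B < m" "m < \<Psi> t" using dense[OF lt] by blast
    obtain m' where m': "m < m'" "m' < \<Psi> t" using dense[OF m(2)] by blast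
    have "\<exists>x\<ge>0. x \<le> t \<and> \<Psi> x = v" if "v < \<Psi> t" for v
    proof (rule IVT')
      show "continuous_on {0..t} \<Psi>" by (rule continuous_on_subset[OF cont]) auto
    qed (use that \<Psi>0 \<open>t \<ge> 0\<close> in simp_all)
    then obtain x x' where x: "0 \<le> x" "x \<le> t" "\<Psi> x = m" and x': "0 \<le> x'" "x' \<le> t" "\<Psi> x' = m'"
      using m m' by meson
    have "x < x'" using young_function_mono[OF Y, of x' x] x x' m' by (meson leD leI)
    then have "\<Psi> x \<le> ennreal (c * 2 powr p * x powr (p + 1))"
      using x x' order.strict_trans2[OF m'(2) top_greatest] by (intro fin[of x x']) simp_all
    also have "\<dots> \<le> ennreal B"
      unfolding B_def using x c p by (intro ennreal_leI mult_left_mono powr_mono2) auto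
    finally show False using m x by auto
  qed
qed

section \<open>Young's inequality and the power lower bound for \<open>\<Phi>\<close>\<close>

lemma complementary_pair_young_inequality:
  assumes "complementary_pair \<Phi> \<Psi>" "x \<ge> 0" "y \<ge> 0"
  shows "ennreal (x * y) \<le> \<Phi> x + \<Psi> y"
proof (cases "\<Phi> x = \<infinity> \<or> \<Psi> y = \<infinity>")
  case False
  then obtain u v where uv: "\<Phi> x = ennreal u" "u \<ge> 0" "\<Psi> y = ennreal v" "v \<ge> 0"
    by (cases "\<Phi> x"; cases "\<Psi> y") auto
  have "ereal (x * y) - enn2ereal (\<Phi> x) \<le> enn2ereal (\<Psi> y)"
    using assms unfolding complementary_pair_def by (auto intro!: SUP_upper)
  then have "x * y \<le> u + v" using uv by simp
  then show ?thesis using uv by (simp add: ennreal_leI flip: ennreal_plus)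
qed auto

lemma complementary_pair_ge_powr:
  assumes pair: "complementary_pair \<Phi> \<Psi>" and p: "p > 0" and c: "c > 0"
    and \<Psi>: "\<And>y. y \<ge> 0 \<Longrightarrow> \<Psi> y \<le> ennreal (c * y powr (p + 1))" and x: "x \<ge> 0"
  shows "ennreal (x powr (1 + 1 / p)) \<le> ennreal (2 * (2 * c) powr (1 / p)) * \<Phi> x"
proof (cases "x = 0")
  case False
  then have x: "x > 0" using x by simp
  \<comment> \<open>This y solves c y^(p+1) = x y / 2, so that the term of \<open>\<Psi>\<close>
    absorbs exactly half of x y in Young's inequality.\<close>
  define y where "y = (x / (2 * c)) powr (1 / p)"
  have y: "y \<ge> 0" by (simp add: y_def)
  have "y powr p = x / (2 * c)" using x p c by (simp add: y_def powr_powr)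
  then have "c * y powr (p + 1) = x * y / 2"
    using c y by (cases "y = 0") (auto simp: powr_add field_simps)
  then have "ennreal (x * y) \<le> \<Phi> x + ennreal (x * y / 2)"
    using complementary_pair_young_inequality[OF pair _ y, of x] \<Psi>[OF y] x
    by (metis add_left_mono less_imp_le order_trans)
  then have "ennreal (x * y / 2) + ennreal (x * y / 2) \<le> \<Phi> x + ennreal (x * y / 2)"
    using x y by (simp flip: ennreal_plus)
  then have "ennreal (x * y / 2) \<le> \<Phi> x" by (simp add: ennreal_add_left_cancel_le add.commute)
  then have "ennreal (2 * (2 * c) powr (1 / p)) * ennreal (x * y / 2) \<le> ennreal (2 * (2 * c) powr (1 / p)) * \<Phi> x"
    by (rule mult_left_mono) simp
  moreover have "x powr (1 + 1 / p) = 2 * (2 * c) powr (1 / p) * (x * y / 2)"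
    using x c by (simp add: y_def powr_add powr_divide)
  then have "ennreal (x powr (1 + 1 / p)) = ennreal (2 * (2 * c) powr (1 / p)) * ennreal (x * y / 2)"
    using x y by (simp only:) (rule ennreal_mult'', simp)
  ultimately show ?thesis by simp
qed simp

section \<open>Invariant measures on a group and its coset space\<close>

text \<open>It translates the sigma-algebra of \<open>radon_measure_on\<close> into a restricted
  Borel algebra, for which continuous functions are known to be measurable.\<close>

lemma sets_restrict_space_eq_sigma_sets_openin:
  "sets (restrict_space borel C) = sigma_sets C {U. openin (top_of_set C) U}"
proof -
  have "sets (restrict_space borel C) = (\<inter>) C ` sigma_sets UNIV {S. open S}"
    by (simp add: sets_restrict_space borel_def)
  also have "\<dots> = {id -` A \<inter> C |A. A \<in> sigma_sets UNIV {S. open S}}"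
    by auto
  also have "\<dots> = sigma_sets C {id -` A \<inter> C |A. A \<in> {S. open S}}"
    by (rule sigma_sets_vimage_commute) auto
  also have "{id -` A \<inter> C |A. A \<in> {S. open S}} = {U. openin (top_of_set C) U}"
    by (auto simp: openin_open)
  finally show ?thesis .
qed

text \<open>This is the measure-theoretic content of a compact group with its Haar measure. Second
  countability identifies the Borel algebra of the product with the product algebra, which makes
  multiplication jointly measurable and opens the way to Fubini.\<close>

locale haar_group = group G + finite_measure haar
  for G :: "'g::second_countable_topology monoid" (structure) and haar :: "'g measure" +
  assumes emeasure_space_1: "emeasure haar (space haar) = 1"
    and sets_haar: "sets haar = sets (restrict_space borel (carrier G))"
    and continuous_mult: "continuous_on (carrier G \<times> carrier G) (\<lambda>(x, y). x \<otimes> y)"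
    and continuous_inv: "continuous_on (carrier G) (\<lambda>x. inv x)"
    and emeasure_l_coset: "g \<in> carrier G \<Longrightarrow> A \<in> sets haar \<Longrightarrow> emeasure haar (g <# A) = emeasure haar A"
begin

lemma space_haar [simp]: "space haar = carrier G"
  using sets_eq_imp_space_eq[OF sets_haar] by (simp add: space_restrict_space)

lemma emeasure_carrier [simp]: "emeasure haar (carrier G) = 1"
  using emeasure_space_1 by simp

lemma borel_measurable_continuous_haar: "continuous_on (carrier G) f \<Longrightarrow> f \<in> borel_measurable haar"
  using borel_measurable_continuous_on_restrict[of "carrier G" f] measurable_cong_sets[OF sets_haar refl]
  by blast

lemma measurable_to_haar:
  "f \<in> N \<rightarrow>\<^sub>M haar \<longleftrightarrow> f \<in> borel_measurable N \<and> f \<in> space N \<rightarrow> carrier G"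
  by (auto simp: measurable_cong_sets[OF refl sets_haar] measurable_restrict_space2_iff Pi_iff)

lemma measurable_haar_mult: "(\<lambda>(x, y). x \<otimes> y) \<in> haar \<Otimes>\<^sub>M haar \<rightarrow>\<^sub>M haar"
proof -
  have id: "(\<lambda>x. x) \<in> borel_measurable haar"
    using measurable_to_haar[of "\<lambda>x. x" haar] by simp
  have "(\<lambda>z. (fst z, snd z)) \<in> haar \<Otimes>\<^sub>M haar \<rightarrow>\<^sub>M (borel \<Otimes>\<^sub>M borel)"
    by (intro measurable_Pair measurable_compose[OF measurable_fst id] measurable_compose[OF measurable_snd id])
  then have "(\<lambda>z. z) \<in> haar \<Otimes>\<^sub>M haar \<rightarrow>\<^sub>M restrict_space borel (carrier G \<times> carrier G)"
    by (intro measurable_restrict_space2) (auto simp: space_pair_measure borel_prod)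
  from measurable_compose[OF this borel_measurable_continuous_on_restrict[OF continuous_mult]]
  show ?thesis by (auto simp: measurable_to_haar space_pair_measure)
qed

lemma measurable_haar_inv: "m_inv G \<in> haar \<rightarrow>\<^sub>M haar"
  using borel_measurable_continuous_haar[OF continuous_inv] by (simp add: measurable_to_haar)

lemma measurable_haar_mult' [measurable (raw)]:
  "f \<in> M \<rightarrow>\<^sub>M haar \<Longrightarrow> g \<in> M \<rightarrow>\<^sub>M haar \<Longrightarrow> (\<lambda>x. f x \<otimes> g x) \<in> M \<rightarrow>\<^sub>M haar"
  using measurable_compose[OF measurable_Pair measurable_haar_mult] by simp

lemma measurable_haar_inv' [measurable (raw)]:
  "f \<in> M \<rightarrow>\<^sub>M haar \<Longrightarrow> (\<lambda>x. inv f x) \<in> M \<rightarrow>\<^sub>M haar"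
  by (rule measurable_compose[OF _ measurable_haar_inv])

lemma distr_haar_left:
  assumes g: "g \<in> carrier G"
  shows "distr haar haar (\<lambda>x. g \<otimes> x) = haar"
proof (rule measure_eqI)
  have [measurable]: "(\<lambda>x. g \<otimes> x) \<in> haar \<rightarrow>\<^sub>M haar"
    using g by (intro measurable_haar_mult' measurable_const) auto
  fix A assume "A \<in> sets (distr haar haar (\<lambda>x. g \<otimes> x))"
  then have A: "A \<in> sets haar" by simp
  then have "A \<subseteq> carrier G" using sets.sets_into_space by fastforce
  then have "(\<lambda>x. g \<otimes> x) -` A \<inter> carrier G = inv g <# A"
    using g by (auto simp: l_coset_def subset_iff m_assoc[symmetric] intro!: bexI[where x = "g \<otimes> _"])
  then show "emeasure (distr haar haar (\<lambda>x. g \<otimes> x)) A = emeasure haar A"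
    using A g by (simp add: emeasure_distr emeasure_l_coset)
qed simp

lemma nn_integral_haar_left:
  assumes [measurable]: "f \<in> borel_measurable haar" and g: "g \<in> carrier G"
  shows "(\<integral>\<^sup>+x. f (g \<otimes> x) \<partial>haar) = (\<integral>\<^sup>+x. f x \<partial>haar)"
proof -
  have [measurable]: "(\<lambda>x. g \<otimes> x) \<in> haar \<rightarrow>\<^sub>M haar"
    using g by (intro measurable_haar_mult' measurable_const) auto
  show ?thesis
    by (subst (2) distr_haar_left[OF g, symmetric]) (simp add: nn_integral_distr)
qed

text \<open>Average over a second variable y, the total mass being 1. A left translation of x by the
  inverse of y turns the integrand into f(x^(-1) y), and after exchanging the integrals a left
  translation of y removes x.\<close>

lemma nn_integral_haar_inv:
  assumes [measurable]: "f \<in> borel_measurable haar"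
  shows "(\<integral>\<^sup>+x. f (inv x) \<partial>haar) = (\<integral>\<^sup>+x. f x \<partial>haar)"
proof -
  interpret pair_sigma_finite haar haar ..
  have "(\<integral>\<^sup>+x. f (inv x) \<partial>haar) = (\<integral>\<^sup>+y. (\<integral>\<^sup>+x. f (inv x) \<partial>haar) \<partial>haar)"
    by simp
  also have "\<dots> = (\<integral>\<^sup>+y. (\<integral>\<^sup>+x. f (inv (inv y \<otimes> x)) \<partial>haar) \<partial>haar)"
    by (intro nn_integral_cong nn_integral_haar_left[symmetric]) auto
  also have "\<dots> = (\<integral>\<^sup>+y. (\<integral>\<^sup>+x. f (inv x \<otimes> y) \<partial>haar) \<partial>haar)"
    by (intro nn_integral_cong) (simp add: inv_mult_group)
  also have "\<dots> = (\<integral>\<^sup>+x. (\<integral>\<^sup>+y. f (inv x \<otimes> y) \<partial>haar) \<partial>haar)"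
    using Fubini[of "\<lambda>(x, y). f (inv x \<otimes> y)"] by simp
  also have "\<dots> = (\<integral>\<^sup>+x. (\<integral>\<^sup>+y. f y \<partial>haar) \<partial>haar)"
    by (intro nn_integral_cong nn_integral_haar_left) auto
  finally show ?thesis by simp
qed

text \<open>Inversion conjugates right translations into left ones.\<close>

lemma nn_integral_haar_right:
  assumes [measurable]: "f \<in> borel_measurable haar" and g: "g \<in> carrier G"
  shows "(\<integral>\<^sup>+x. f (x \<otimes> g) \<partial>haar) = (\<integral>\<^sup>+x. f x \<partial>haar)"
proof -
  have [measurable]: "(\<lambda>x. g) \<in> N \<rightarrow>\<^sub>M haar" for N :: "'g measure"
    using g by (intro measurable_const) auto
  have "(\<integral>\<^sup>+x. f (x \<otimes> g) \<partial>haar) = (\<integral>\<^sup>+x. f (inv x \<otimes> g) \<partial>haar)"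
    by (intro nn_integral_haar_inv[symmetric]) simp
  also have "\<dots> = (\<integral>\<^sup>+x. f (inv (inv g \<otimes> x)) \<partial>haar)"
    using g by (intro nn_integral_cong) (simp add: inv_mult_group)
  also have "\<dots> = (\<integral>\<^sup>+x. f (inv x) \<partial>haar)"
    using g by (intro nn_integral_haar_left[of "\<lambda>x. f (inv x)"]) auto
  finally show ?thesis by (simp add: nn_integral_haar_inv)
qed

lemma distr_haar_right:
  assumes g: "g \<in> carrier G"
  shows "distr haar haar (\<lambda>x. x \<otimes> g) = haar"
proof (rule measure_eqI)
  have [measurable]: "(\<lambda>x. x \<otimes> g) \<in> haar \<rightarrow>\<^sub>M haar"
    using g by (intro measurable_haar_mult' measurable_const) auto
  fix A assume "A \<in> sets (distr haar haar (\<lambda>x. x \<otimes> g))"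
  then have [measurable]: "A \<in> sets haar" by simp
  have "emeasure (distr haar haar (\<lambda>x. x \<otimes> g)) A = (\<integral>\<^sup>+x. indicator A (x \<otimes> g) \<partial>haar)"
    using nn_integral_distr[of "\<lambda>x. x \<otimes> g" haar haar "indicator A"] by simp
  also have "\<dots> = emeasure haar A"
    by (subst nn_integral_haar_right[OF _ g]) simp_all
  finally show "emeasure (distr haar haar (\<lambda>x. x \<otimes> g)) A = emeasure haar A" .
qed simp

lemma integral_haar_left:
  fixes f :: "'g \<Rightarrow> complex"
  assumes "f \<in> borel_measurable haar" and g: "g \<in> carrier G"
  shows "(\<integral>x. f (g \<otimes> x) \<partial>haar) = (\<integral>x. f x \<partial>haar)"
proof -
  have "(\<lambda>x. g \<otimes> x) \<in> haar \<rightarrow>\<^sub>M haar"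
    using g by (intro measurable_haar_mult' measurable_const) auto
  from integral_distr[OF this assms(1)] show ?thesis by (simp add: distr_haar_left[OF g])
qed

lemma integral_haar_right:
  fixes f :: "'g \<Rightarrow> complex"
  assumes "f \<in> borel_measurable haar" and g: "g \<in> carrier G"
  shows "(\<integral>x. f (x \<otimes> g) \<partial>haar) = (\<integral>x. f x \<partial>haar)"
proof -
  have "(\<lambda>x. x \<otimes> g) \<in> haar \<rightarrow>\<^sub>M haar"
    using g by (intro measurable_haar_mult' measurable_const) auto
  from integral_distr[OF this assms(1)] show ?thesis by (simp add: distr_haar_right[OF g])
qed

section \<open>The quotient map onto G/K and the invariant measure\<close>

lemma open_in_sets_haar: "openin (top_of_set (carrier G)) U \<Longrightarrow> U \<in> sets haar"
  by (simp add: sets_haar sets_restrict_space_eq_sigma_sets_openin)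

text \<open>The preimage of the image of W is the union of the translates W k^(-1) over k in K, each
  of which is open.\<close>

lemma openin_coset_image:
  assumes K: "subgroup K G" and W: "openin (top_of_set (carrier G)) W"
  shows "openin (coset_topology G K) ((\<lambda>g. g <# K) ` W)"
proof -
  have WG: "W \<subseteq> carrier G" using openin_imp_subset[OF W] .
  have KG: "K \<subseteq> carrier G" using K by (rule subgroup.subset)
  have eq_iff: "g <# K = w <# K \<longleftrightarrow> (\<exists>k\<in>K. g \<otimes> k = w)" if g: "g \<in> carrier G" and w: "w \<in> carrier G" for g w
  proof
    assume "g <# K = w <# K"
    moreover have "w \<otimes> \<one> \<in> w <# K"
      using subgroup.one_closed[OF K] by (auto simp: l_coset_def)
    ultimately have "w \<in> g <# K" using w by simp
    then show "\<exists>k\<in>K. g \<otimes> k = w" by (auto simp: l_coset_def)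
  next
    assume "\<exists>k\<in>K. g \<otimes> k = w"
    then show "g <# K = w <# K"
      using l_repr_independence[of w g K] K g by (auto simp: l_coset_def)
  qed
  have "{g \<in> carrier G. g <# K \<in> (\<lambda>g. g <# K) ` W} = (\<Union>k\<in>K. carrier G \<inter> (\<lambda>g. g \<otimes> k) -` W)"
    using eq_iff WG by (auto simp: image_iff subset_iff)
  moreover have op: "openin (top_of_set (carrier G)) (carrier G \<inter> (\<lambda>g. g \<otimes> k) -` W)" if "k \<in> K" for k
  proof (rule continuous_openin_preimage[OF _ _ W])
    show "continuous_on (carrier G) (\<lambda>g. g \<otimes> k)"
    proof -
      have "continuous_on (carrier G) (\<lambda>g. (g, k))" by (intro continuous_intros)
      moreover have "(\<lambda>g. (g, k)) ` carrier G \<subseteq> carrier G \<times> carrier G" using that KG by auto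
      ultimately show ?thesis using continuous_on_compose2[OF continuous_mult] by fastforce
    qed
  qed (use that KG in auto)
  moreover have "openin (top_of_set (carrier G)) (\<Union>k\<in>K. carrier G \<inter> (\<lambda>g. g \<otimes> k) -` W)"
    by (rule openin_Union) (use op in blast)
  ultimately show ?thesis
    using WG by (auto simp: openin_coset_topology LCOSETS_def)
qed

text \<open>Joint measurability of the action, as required by Fubini. An open set of the product
  must be exhibited inside the product sigma-algebra, so it is written as a countable union of
  rectangles: their sides come from a countable basis of G, and the second side is pushed to G/K by
  the open quotient map.\<close>

lemma sets_action_preimage:
  assumes K: "subgroup K G" and U: "openin (coset_topology G K) U"
    and \<mu>: "sets \<mu> = sigma_sets (lcosets K) {U. openin (coset_topology G K) U}"
  shows "{(g, x). g \<in> carrier G \<and> x \<in> lcosets K \<and> g <# x \<in> U} \<in> sets (haar \<Otimes>\<^sub>M \<mu>)"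
proof -
  define U' where "U' = {g \<in> carrier G. g <# K \<in> U}"
  have KG: "K \<subseteq> carrier G" using K by (rule subgroup.subset)
  obtain B :: "'g set set" where B: "countable B" "topological_basis B"
    using ex_countable_basis by blast
  \<comment> \<open>Pairs of basic sets whose product is carried into the preimage of U; continuity
    of multiplication makes them cover.\<close>
  define P where "P = {(V, W) \<in> B \<times> B. \<forall>v\<in>V \<inter> carrier G. \<forall>w\<in>W \<inter> carrier G. v \<otimes> w \<in> U'}"
  have "openin (top_of_set (carrier G)) U'"
    using U by (simp add: U'_def openin_coset_topology)
  then have "openin (top_of_set (carrier G \<times> carrier G))
    ((carrier G \<times> carrier G) \<inter> (\<lambda>(x, y). x \<otimes> y) -` U')"
    by (intro continuous_openin_preimage[OF continuous_mult]) auto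
  then obtain Z where Z: "open Z"
    "(carrier G \<times> carrier G) \<inter> (\<lambda>(x, y). x \<otimes> y) -` U' = (carrier G \<times> carrier G) \<inter> Z"
    by (auto simp: openin_open)
  have cover: "\<exists>(V, W)\<in>P. g \<in> V \<and> y \<in> W" if gy: "g \<in> carrier G" "y \<in> carrier G" "g \<otimes> y \<in> U'" for g y
  proof -
    have "(g, y) \<in> Z" using Z gy by auto
    then obtain V W where VW: "open V" "open W" "g \<in> V" "y \<in> W" "V \<times> W \<subseteq> Z"
      using open_prod_elim[OF Z(1)] by (metis mem_Sigma_iff)
    obtain V' where V': "V' \<in> B" "g \<in> V'" "V' \<subseteq> V"
      using topological_basisE[OF B(2) VW(1,3)] by blast
    obtain W' where W': "W' \<in> B" "y \<in> W'" "W' \<subseteq> W"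
      using topological_basisE[OF B(2) VW(2,4)] by blast
    have "v \<otimes> w \<in> U'" if "v \<in> V' \<inter> carrier G" "w \<in> W' \<inter> carrier G" for v w
    proof -
      have "(v, w) \<in> (carrier G \<times> carrier G) \<inter> Z" using that V' W' VW(5) by auto
      then show ?thesis unfolding Z(2)[symmetric] by auto
    qed
    then have "(V', W') \<in> P" using V' W' by (simp add: P_def)
    then show ?thesis using V' W' by blast
  qed
  have N_eq: "{(g, x). g \<in> carrier G \<and> x \<in> lcosets K \<and> g <# x \<in> U} =
      (\<Union>(V, W)\<in>P. (carrier G \<inter> V) \<times> ((\<lambda>g. g <# K) ` (carrier G \<inter> W)))" (is "?N = ?R")
  proof (intro equalityI subsetI)
    fix z assume "z \<in> ?N"
    then obtain g y where z: "z = (g, y <# K)" "g \<in> carrier G" "y \<in> carrier G" "g \<otimes> y \<in> U'"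
      using KG by (auto simp: LCOSETS_def U'_def lcos_m_assoc)
    then show "z \<in> ?R" using cover[of g y] by blast
  next
    fix z assume "z \<in> ?R"
    then show "z \<in> ?N" using KG
      by (auto simp: P_def U'_def LCOSETS_def lcos_m_assoc)
  qed
  have "countable P"
    by (rule countable_subset[of _ "B \<times> B"]) (use B in \<open>auto simp: P_def\<close>)
  have "(carrier G \<inter> V) \<times> ((\<lambda>g. g <# K) ` (carrier G \<inter> W)) \<in> sets (haar \<Otimes>\<^sub>M \<mu>)"
    if "(V, W) \<in> P" for V W
  proof -
    have "open V" "open W" using that B(2) by (auto simp: P_def topological_basis_open)
    then have "openin (top_of_set (carrier G)) (carrier G \<inter> V)" "openin (top_of_set (carrier G)) (carrier G \<inter> W)"
      by (auto simp: openin_open_Int)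
    then show ?thesis
      using openin_coset_image[OF K] by (intro pair_measureI open_in_sets_haar) (auto simp: \<mu>)
  qed
  then have "(\<lambda>(V, W). (carrier G \<inter> V) \<times> ((\<lambda>g. g <# K) ` (carrier G \<inter> W))) ` P \<subseteq> sets (haar \<Otimes>\<^sub>M \<mu>)"
    by auto
  show ?thesis
    unfolding N_eq by (rule sets.countable_UN') fact+
qed

text \<open>Averaging the invariance of \<open>\<mu>\<close> over \<open>G\<close> and exchanging the integrals identifies \<open>\<mu>\<close>
  on open sets.\<close>

theorem distr_haar_coset:
  assumes K: "subgroup K G" and inv: "invariant_prob_measure G K \<mu>"
  shows "(\<lambda>g. g <# K) \<in> haar \<rightarrow>\<^sub>M \<mu>" and "distr haar \<mu> (\<lambda>g. g <# K) = \<mu>"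
proof -
  let ?q = "\<lambda>g. g <# K" and ?T = "coset_topology G K"
  have KG: "K \<subseteq> carrier G" using K by (rule subgroup.subset)
  have \<mu>: "space \<mu> = lcosets K" "sets \<mu> = sigma_sets (lcosets K) {U. openin ?T U}"
    "emeasure \<mu> (space \<mu>) = 1"
    "\<And>g A. g \<in> carrier G \<Longrightarrow> A \<in> sets \<mu> \<Longrightarrow> emeasure \<mu> ((\<lambda>x. g <# x) ` A) = emeasure \<mu> A"
    using inv by (auto simp: invariant_prob_measure_def radon_measure_on_def topspace_coset_topology)
  have sub: "{U. openin ?T U} \<subseteq> Pow (lcosets K)" by (auto simp: openin_coset_topology)
  show meas: "?q \<in> haar \<rightarrow>\<^sub>M \<mu>"
  proof (rule measurable_sigma_sets[OF \<mu>(2) sub])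
    show "?q \<in> space haar \<rightarrow> lcosets K" by (auto simp: LCOSETS_def)
    fix U assume "U \<in> {U. openin ?T U}"
    then have "openin (top_of_set (carrier G)) {g \<in> carrier G. ?q g \<in> U}"
      by (simp add: openin_coset_topology)
    moreover have "{g \<in> carrier G. ?q g \<in> U} = ?q -` U \<inter> space haar" by auto
    ultimately show "?q -` U \<inter> space haar \<in> sets haar" using open_in_sets_haar by metis
  qed
  interpret \<mu>: finite_measure \<mu> by standard (simp add: \<mu>(3))
  interpret pair_sigma_finite haar \<mu> ..
  have one: "emeasure \<mu> (lcosets K) = 1" using \<mu>(1,3) by simp
  have act: "g <# x \<in> lcosets K" "inv g <# (g <# x) = x" "g <# (inv g <# x) = x"
    if "x \<in> lcosets K" "g \<in> carrier G" for x g
    using that KG by (auto simp: LCOSETS_def lcos_m_assoc m_assoc[symmetric])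
  have eq: "emeasure haar {g \<in> carrier G. ?q g \<in> U} = emeasure \<mu> U" if U: "openin ?T U" for U
  proof -
    define U' where "U' = {g \<in> carrier G. ?q g \<in> U}"
    have [measurable]: "U' \<in> sets haar"
      using U unfolding U'_def by (intro open_in_sets_haar) (simp add: openin_coset_topology)
    \<comment> \<open>The double integral of the indicator of gx in U is computed in both orders.
      For fixed g, invariance gives \<open>\<mu>\<close>(U); for fixed x = yK, right invariance of
      Haar measure gives the measure of the preimage of U.\<close>
    define N where "N = {(g, x). g \<in> carrier G \<and> x \<in> lcosets K \<and> g <# x \<in> U}"
    have N [measurable]: "N \<in> sets (haar \<Otimes>\<^sub>M \<mu>)"
      unfolding N_def by (rule sets_action_preimage[OF K U \<mu>(2)])
    have US: "U \<in> sets \<mu>" "U \<subseteq> lcosets K" using U sub by (auto simp: \<mu>(2))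
    have "(\<integral>\<^sup>+x. indicator N (g, x) \<partial>\<mu>) = emeasure \<mu> U" if "g \<in> carrier G" for g
    proof -
      have img: "{x \<in> lcosets K. g <# x \<in> U} = (\<lambda>x. inv g <# x) ` U" (is "?A = _")
      proof (intro equalityI subsetI)
        fix x assume "x \<in> ?A"
        then show "x \<in> (\<lambda>x. inv g <# x) ` U" using act(2)[of x g] that by (intro image_eqI[where x = "g <# x"]) auto
      next
        fix x assume "x \<in> (\<lambda>x. inv g <# x) ` U"
        then obtain u where u: "u \<in> U" "x = inv g <# u" by blast
        then have "u \<in> lcosets K" using US by blast
        then show "x \<in> ?A" using u act(1)[of u "inv g"] act(3)[of u g] that by simp
      qed
      have "Pair g -` N = ?A" using that by (auto simp: N_def)
      then have "?A \<in> sets \<mu>" using sets_Pair1[OF N, of g] by simp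
      moreover have "(\<integral>\<^sup>+x. indicator N (g, x) \<partial>\<mu>) = (\<integral>\<^sup>+x. indicator ?A x \<partial>\<mu>)"
        using that by (intro nn_integral_cong) (auto simp: N_def \<mu>(1) indicator_def)
      ultimately have "(\<integral>\<^sup>+x. indicator N (g, x) \<partial>\<mu>) = emeasure \<mu> ?A" by simp
      also have "\<dots> = emeasure \<mu> U" unfolding img using that US by (intro \<mu>(4)) auto
      finally show ?thesis .
    qed
    then have "(\<integral>\<^sup>+g. (\<integral>\<^sup>+x. indicator N (g, x) \<partial>\<mu>) \<partial>haar) = (\<integral>\<^sup>+g. emeasure \<mu> U \<partial>haar)"
      by (intro nn_integral_cong) simp
    moreover have "(\<integral>\<^sup>+g. indicator N (g, x) \<partial>haar) = emeasure haar U'" if x: "x \<in> lcosets K" for x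
    proof -
      obtain y where y: "y \<in> carrier G" "x = y <# K" using x by (auto simp: LCOSETS_def)
      have "(\<integral>\<^sup>+g. indicator N (g, x) \<partial>haar) = (\<integral>\<^sup>+g. indicator U' (g \<otimes> y) \<partial>haar)"
        using y x KG by (intro nn_integral_cong) (auto simp: N_def U'_def lcos_m_assoc indicator_def)
      also have "\<dots> = emeasure haar U'"
        using y by (subst nn_integral_haar_right) auto
      finally show ?thesis .
    qed
    then have "(\<integral>\<^sup>+x. (\<integral>\<^sup>+g. indicator N (g, x) \<partial>haar) \<partial>\<mu>) = (\<integral>\<^sup>+x. emeasure haar U' \<partial>\<mu>)"
      by (intro nn_integral_cong) (simp add: \<mu>(1))
    moreover have "(\<integral>\<^sup>+x. (\<integral>\<^sup>+g. indicator N (g, x) \<partial>haar) \<partial>\<mu>) = (\<integral>\<^sup>+g. (\<integral>\<^sup>+x. indicator N (g, x) \<partial>\<mu>) \<partial>haar)"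
      by (rule Fubini) simp
    ultimately show ?thesis by (simp add: U'_def \<mu>(1) one)
  qed
  show "distr haar \<mu> ?q = \<mu>"
  proof (rule measure_eqI_generator_eq[where E = "{U. openin ?T U}" and A = "\<lambda>_. lcosets K" and \<Omega> = "lcosets K"])
    show "Int_stable {U. openin ?T U}" by (auto simp: Int_stable_def)
    show "emeasure (distr haar \<mu> ?q) U = emeasure \<mu> U" if "U \<in> {U. openin ?T U}" for U
    proof -
      have "U \<in> sets \<mu>" using that by (auto simp: \<mu>(2))
      moreover have "?q -` U \<inter> space haar = {g \<in> carrier G. ?q g \<in> U}" by auto
      ultimately show ?thesis using that meas eq by (simp add: emeasure_distr)
    qed
    have "openin ?T (lcosets K)" by (metis openin_topspace topspace_coset_topology)
    then show "range (\<lambda>_::nat. lcosets K) \<subseteq> {U. openin ?T U}" by auto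
    show "emeasure (distr haar \<mu> ?q) (lcosets K) \<noteq> \<infinity>" for i :: nat
      using sets.top[of \<mu>] by (simp add: emeasure_distr[OF meas] \<mu>(1))
  qed (use sub \<mu>(2) in auto)
qed

end

section \<open>Schur's lemma\<close>

lemma dim_mat_adjoint [simp]:
  "dim_row (mat_adjoint A) = dim_col A" "dim_col (mat_adjoint A) = dim_row A"
  by (auto simp: mat_adjoint_def)

lemma index_mat_adjoint [simp]:
  fixes A :: "complex mat"
  shows "i < dim_col A \<Longrightarrow> j < dim_row A \<Longrightarrow> mat_adjoint A $$ (i, j) = cnj (A $$ (j, i))"
  by (simp add: mat_adjoint_def mat_of_rows_def)

lemma mat_adjoint_carrier [simp, intro]: "A \<in> carrier_mat n m \<Longrightarrow> mat_adjoint A \<in> carrier_mat m n"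
  by (auto intro!: carrier_matI)

lemma mat_adjoint_mat_adjoint [simp]: "mat_adjoint (mat_adjoint A) = (A :: complex mat)"
  by (rule eq_matI) auto

lemma index_mult_mat_sum:
  "A \<in> carrier_mat n k \<Longrightarrow> B \<in> carrier_mat k m \<Longrightarrow> i < n \<Longrightarrow> j < m \<Longrightarrow>
    (A * B) $$ (i, j) = (\<Sum>l<k. A $$ (i, l) * B $$ (l, j))"
  by (auto simp: scalar_prod_def lessThan_atLeast0 intro!: sum.cong)

lemma mat_adjoint_mult:
  fixes A B :: "complex mat"
  assumes "A \<in> carrier_mat n k" "B \<in> carrier_mat k m"
  shows "mat_adjoint (A * B) = mat_adjoint B * mat_adjoint A"
proof (rule eq_matI)
  fix i j assume "i < dim_row (mat_adjoint B * mat_adjoint A)" "j < dim_col (mat_adjoint B * mat_adjoint A)"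
  then have ij: "i < m" "j < n" using assms by auto
  then have "mat_adjoint (A * B) $$ (i, j) = cnj (\<Sum>l<k. A $$ (j, l) * B $$ (l, i))"
    using assms by (simp del: index_mult_mat(1) add: index_mult_mat_sum[OF assms])
  also have "\<dots> = (\<Sum>l<k. mat_adjoint B $$ (i, l) * mat_adjoint A $$ (l, j))"
    using assms ij by (auto simp: mult.commute intro!: sum.cong)
  also have "\<dots> = (mat_adjoint B * mat_adjoint A) $$ (i, j)"
    using assms ij by (intro index_mult_mat_sum[symmetric]) auto
  finally show "mat_adjoint (A * B) $$ (i, j) = (mat_adjoint B * mat_adjoint A) $$ (i, j)" .
qed (use assms in auto)

lemma unitary_mat_adjoint_mult:
  "unitary_mat d U \<Longrightarrow> mat_adjoint U * U = 1\<^sub>m d"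
  using mat_mult_left_right_inverse[of U d "mat_adjoint U"] by (simp add: unitary_mat_def)

lemma unitary_mat_adjoint: "unitary_mat d U \<Longrightarrow> unitary_mat d (mat_adjoint U)"
  using unitary_mat_adjoint_mult[of d U] by (auto simp: unitary_mat_def)

lemma unitary_mat_mult:
  assumes "unitary_mat d U" "unitary_mat d V"
  shows "unitary_mat d (U * V)"
proof -
  have c: "U \<in> carrier_mat d d" "V \<in> carrier_mat d d" using assms by (auto simp: unitary_mat_def)
  then have "mat_adjoint V * mat_adjoint U \<in> carrier_mat d d"
    by (intro mult_carrier_mat mat_adjoint_carrier)
  with c have "(U * V) * mat_adjoint (U * V) = U * (V * mat_adjoint V) * mat_adjoint U"
    using assoc_mult_mat[of U d d V d "mat_adjoint V * mat_adjoint U" d]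
      assoc_mult_mat[of V d d "mat_adjoint V" d "mat_adjoint U" d]
      assoc_mult_mat[of U d d "V * mat_adjoint V" d "mat_adjoint U" d]
    by (simp add: mat_adjoint_mult[OF c])
  also have "\<dots> = 1\<^sub>m d" using assms c by (simp add: unitary_mat_def)
  finally show ?thesis using c by (simp add: unitary_mat_def)
qed

lemma mult_mat_adjoint_index:
  fixes A :: "complex mat"
  assumes "A \<in> carrier_mat n m" "i < n" "j < n"
  shows "(A * mat_adjoint A) $$ (i, j) = (\<Sum>l<m. A $$ (i, l) * cnj (A $$ (j, l)))"
  using assms by (subst index_mult_mat_sum[of _ n m _ n]) (auto intro!: sum.cong)

lemma adjoint_mult_mat_index:
  fixes A :: "complex mat"
  assumes "A \<in> carrier_mat n m" "i < m" "j < m"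
  shows "(mat_adjoint A * A) $$ (i, j) = (\<Sum>l<n. cnj (A $$ (l, i)) * A $$ (l, j))"
  using assms by (subst index_mult_mat_sum[of _ m n _ m]) (auto intro!: sum.cong)

lemma unitary_mat_columns:
  assumes "unitary_mat d U" "i < d" "j < d"
  shows "(\<Sum>l<d. cnj (U $$ (l, i)) * U $$ (l, j)) = (if i = j then 1 else 0)"
  using adjoint_mult_mat_index[of U d d i j] unitary_mat_adjoint_mult[OF assms(1)] assms
  by (auto simp: unitary_mat_def)

lemma unitary_mat_column_norm:
  assumes "unitary_mat d U" "i < d"
  shows "(\<Sum>l<d. (cmod (U $$ (l, i)))\<^sup>2) = 1"
proof -
  have "complex_of_real (\<Sum>l<d. (cmod (U $$ (l, i)))\<^sup>2) = (\<Sum>l<d. cnj (U $$ (l, i)) * U $$ (l, i))"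
    by (simp add: complex_norm_square mult.commute del: of_real_power)
  also have "\<dots> = 1" using unitary_mat_columns[OF assms(1,2,2)] by simp
  finally show ?thesis using of_real_eq_1_iff by blast
qed

lemma subspace_module_vecI:
  assumes "W \<subseteq> carrier_vec d" "0\<^sub>v d \<in> W" "\<And>v w. v \<in> W \<Longrightarrow> w \<in> W \<Longrightarrow> v + w \<in> W"
    "\<And>c v. v \<in> W \<Longrightarrow> c \<cdot>\<^sub>v v \<in> W"
  shows "VectorSpace.subspace class_ring W (module_vec TYPE(complex) d)"
proof -
  interpret vec_space "TYPE(complex)" d .
  show ?thesis
    unfolding VectorSpace.subspace_def submodule_def
    using assms vec_vs vec_module by (auto simp: module_vec_simps)
qed

lemma complex_mat_eigenvalue_exists:
  fixes B :: "complex mat"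
  assumes B: "B \<in> carrier_mat d d" and d: "d > 0"
  obtains c where "eigenvalue B c"
proof -
  have "degree (char_poly B) = d" using degree_monic_char_poly[OF B] by simp
  then have "\<not> constant (poly (char_poly B))"
    using d by (simp add: constant_degree)
  then obtain c where "poly (char_poly B) c = 0"
    using fundamental_theorem_of_algebra by blast
  then show ?thesis using eigenvalue_root_char_poly[OF B] that by blast
qed

text \<open>Over the complex numbers B has an eigenvector. The eigenspace is invariant because B
  commutes with the representation, so irreducibility makes it the whole space.\<close>

lemma irreducible_rep_commutant:
  assumes irr: "irreducible_rep G (d, \<rho>)" and B: "B \<in> carrier_mat d d"
    and \<rho>: "\<And>g. g \<in> carrier G \<Longrightarrow> \<rho> g \<in> carrier_mat d d"
    and comm: "\<And>g. g \<in> carrier G \<Longrightarrow> \<rho> g * B = B * \<rho> g"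
  obtains c where "B = c \<cdot>\<^sub>m 1\<^sub>m d"
proof -
  have d: "d > 0" using irr by (simp add: irreducible_rep_def)
  obtain c where c: "eigenvalue B c" using complex_mat_eigenvalue_exists[OF B d] .
  define W where "W = {v \<in> carrier_vec d. B *\<^sub>v v = c \<cdot>\<^sub>v v}"
  have "VectorSpace.subspace class_ring W (module_vec TYPE(complex) d)"
  proof (rule subspace_module_vecI)
    show "v + w \<in> W" if "v \<in> W" "w \<in> W" for v w
      using that B by (auto simp: W_def mult_add_distrib_mat_vec smult_add_distrib_vec)
    show "a \<cdot>\<^sub>v v \<in> W" if "v \<in> W" for a v
      using that B by (auto simp: W_def mult_mat_vec smult_smult_assoc mult.commute)
    show "0\<^sub>v d \<in> W" using B by (auto simp: W_def)
  qed (auto simp: W_def)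
  moreover have "\<rho> g *\<^sub>v w \<in> W" if "g \<in> carrier G" "w \<in> W" for g w
  proof -
    have w: "w \<in> carrier_vec d" "B *\<^sub>v w = c \<cdot>\<^sub>v w" using that by (auto simp: W_def)
    have "B *\<^sub>v (\<rho> g *\<^sub>v w) = \<rho> g *\<^sub>v (B *\<^sub>v w)"
      using comm[OF that(1)] assoc_mult_mat_vec[OF B \<rho>[OF that(1)] w(1)]
        assoc_mult_mat_vec[OF \<rho>[OF that(1)] B w(1)] by simp
    also have "\<dots> = c \<cdot>\<^sub>v (\<rho> g *\<^sub>v w)" using w \<rho>[OF that(1)] by (simp add: mult_mat_vec)
    finally show ?thesis using w \<rho>[OF that(1)] by (auto simp: W_def)
  qed
  ultimately have "W = {0\<^sub>v d} \<or> W = carrier_vec d"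
    using irr unfolding irreducible_rep_def by blast
  moreover have "W \<noteq> {0\<^sub>v d}"
    using c B by (auto simp: W_def eigenvalue_def eigenvector_def)
  ultimately have W: "W = carrier_vec d" by blast
  have "B = c \<cdot>\<^sub>m 1\<^sub>m d"
  proof (rule eq_matI)
    fix i j assume "i < dim_row (c \<cdot>\<^sub>m 1\<^sub>m d)" "j < dim_col (c \<cdot>\<^sub>m 1\<^sub>m d)"
    then have ij: "i < d" "j < d" by auto
    have "unit_vec d j \<in> W" by (simp add: W)
    then have "(B *\<^sub>v unit_vec d j) $ i = (c \<cdot>\<^sub>v unit_vec d j) $ i" by (simp add: W_def)
    then show "B $$ (i, j) = (c \<cdot>\<^sub>m 1\<^sub>m d) $$ (i, j)" using ij B by simp
  qed (use B in auto)
  then show ?thesis using that by blast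
qed


section \<open>Unitary representations, their equivalence and intertwiners\<close>

lemma unitary_rep_unitary: "unitary_rep G (d, \<rho>) \<Longrightarrow> g \<in> carrier G \<Longrightarrow> unitary_mat d (\<rho> g)"
  by (simp add: unitary_rep_def)

lemma unitary_rep_carrier: "unitary_rep G (d, \<rho>) \<Longrightarrow> g \<in> carrier G \<Longrightarrow> \<rho> g \<in> carrier_mat d d"
  by (simp add: unitary_rep_def unitary_mat_def)

lemma unitary_irreps_carrier:
  assumes "R \<in> unitary_irreps G" "g \<in> carrier G" "fst R = n"
  shows "snd R g \<in> carrier_mat n n"
  using assms by (cases R) (auto simp: unitary_irreps_def unitary_rep_carrier)

lemma unitary_rep_mult:
  "unitary_rep G (d, \<rho>) \<Longrightarrow> g \<in> carrier G \<Longrightarrow> h \<in> carrier G \<Longrightarrow> \<rho> (g \<otimes>\<^bsub>G\<^esub> h) = \<rho> g * \<rho> h"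
  by (simp add: unitary_rep_def)

lemma unitary_mat_cancel:
  assumes "unitary_mat d U" "A \<in> carrier_mat d n"
  shows "U * (mat_adjoint U * A) = A" "mat_adjoint U * (U * A) = A"
proof -
  have c: "U \<in> carrier_mat d d" "mat_adjoint U \<in> carrier_mat d d"
    using assms by (auto simp: unitary_mat_def)
  show "U * (mat_adjoint U * A) = A"
    using assoc_mult_mat[OF c(1) c(2) assms(2)] assms by (simp add: unitary_mat_def)
  show "mat_adjoint U * (U * A) = A"
    using assoc_mult_mat[OF c(2) c(1) assms(2)] assms by (simp add: unitary_mat_adjoint_mult)
qed

text \<open>\<open>unitary_rep\<close> does not demand that the unit go to the identity matrix. It
  follows because the image of the unit is idempotent and, being unitary, can be cancelled.\<close>

lemma unitary_rep_inv:
  fixes G :: "'g::topological_space monoid" (structure)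
  assumes "group G" and R: "unitary_rep G (d, \<rho>)" and g: "g \<in> carrier G"
  shows "\<rho> (inv g) = mat_adjoint (\<rho> g)"
proof -
  interpret group G by fact
  note c = unitary_rep_carrier[OF R]
  have one: "\<rho> \<one> = 1\<^sub>m d"
  proof -
    have "\<rho> \<one> * \<rho> \<one> = \<rho> \<one>" using unitary_rep_mult[OF R, of \<one> \<one>] by simp
    then have "mat_adjoint (\<rho> \<one>) * (\<rho> \<one> * \<rho> \<one>) = mat_adjoint (\<rho> \<one>) * \<rho> \<one>" by simp
    then show ?thesis
      using unitary_mat_cancel(2)[OF unitary_rep_unitary[OF R] c, of \<one> \<one>]
        unitary_mat_adjoint_mult[OF unitary_rep_unitary[OF R, of \<one>]] by simp
  qed
  have "\<rho> g * \<rho> (inv g) = 1\<^sub>m d"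
    using unitary_rep_mult[OF R g, of "inv g"] g one by simp
  then have "mat_adjoint (\<rho> g) * (\<rho> g * \<rho> (inv g)) = mat_adjoint (\<rho> g)"
    using c[OF g] by (simp add: right_mult_one_mat')
  then show ?thesis
    using unitary_mat_cancel(2)[OF unitary_rep_unitary[OF R g] c[of "inv g"]] g by simp
qed

text \<open>With this, members of distinct classes of the dual are inequivalent, which orthogonality
  will need, and members of a class are irreducible.\<close>

lemma unitary_equiv_equiv: "equiv (unitary_irreps G) (unitary_equiv G)"
proof (rule equivI)
  show "unitary_equiv G \<subseteq> unitary_irreps G \<times> unitary_irreps G"
    by (auto simp: unitary_equiv_def)
  show "refl_on (unitary_irreps G) (unitary_equiv G)"
  proof (rule refl_onI)
    fix R assume R: "R \<in> unitary_irreps G"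
    then have "snd R g \<in> carrier_mat (fst R) (fst R)" if "g \<in> carrier G" for g
      using that by (intro unitary_irreps_carrier) auto
    then have "1\<^sub>m (fst R) * snd R g = snd R g * 1\<^sub>m (fst R)" if "g \<in> carrier G" for g
      using left_mult_one_mat right_mult_one_mat that by metis
    moreover have "mat_adjoint (1\<^sub>m n) = (1\<^sub>m n :: complex mat)" for n
      by (rule eq_matI) auto
    then have "unitary_mat n (1\<^sub>m n)" for n by (simp add: unitary_mat_def)
    ultimately show "(R, R) \<in> unitary_equiv G"
      using R by (auto simp: unitary_equiv_def intro!: exI[where x = "1\<^sub>m (fst R)"])
  qed
  show "sym (unitary_equiv G)"
  proof (rule symI)
    fix R S assume "(R, S) \<in> unitary_equiv G"
    then obtain U where RS: "R \<in> unitary_irreps G" "S \<in> unitary_irreps G" "fst R = fst S"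
      and U: "unitary_mat (fst R) U" "\<forall>g\<in>carrier G. U * snd R g = snd S g * U"
      by (auto simp: unitary_equiv_def)
    let ?n = "fst S"
    have cU: "U \<in> carrier_mat ?n ?n" using U RS by (simp add: unitary_mat_def)
    have "mat_adjoint U * snd S g = snd R g * mat_adjoint U" if g: "g \<in> carrier G" for g
    proof -
      have c: "snd R g \<in> carrier_mat ?n ?n" "snd S g \<in> carrier_mat ?n ?n"
        using RS g by (auto intro: unitary_irreps_carrier)
      have "snd R g = mat_adjoint U * (snd S g * U)"
        using unitary_mat_cancel(2)[of ?n U "snd R g" ?n] U RS c g by simp
      also have "\<dots> = mat_adjoint U * snd S g * U"
        using cU c by (intro assoc_mult_mat[symmetric]) auto
      finally have "snd R g * mat_adjoint U = mat_adjoint U * snd S g * U * mat_adjoint U" by simp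
      also have "\<dots> = mat_adjoint U * snd S g * (U * mat_adjoint U)"
        using cU c by (intro assoc_mult_mat) (auto intro!: mult_carrier_mat)
      also have "\<dots> = mat_adjoint U * snd S g"
        using U RS cU c by (simp add: unitary_mat_def right_mult_one_mat')
      finally show ?thesis by simp
    qed
    then show "(S, R) \<in> unitary_equiv G"
      using RS U unitary_mat_adjoint[of ?n U] by (auto simp: unitary_equiv_def)
  qed
  show "trans (unitary_equiv G)"
  proof (rule transI)
    fix R S T assume "(R, S) \<in> unitary_equiv G" "(S, T) \<in> unitary_equiv G"
    then obtain U V where RST: "R \<in> unitary_irreps G" "S \<in> unitary_irreps G" "T \<in> unitary_irreps G"
        "fst R = fst T" "fst S = fst T"
      and U: "unitary_mat (fst T) U" "\<forall>g\<in>carrier G. U * snd R g = snd S g * U"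
      and V: "unitary_mat (fst T) V" "\<forall>g\<in>carrier G. V * snd S g = snd T g * V"
      by (auto simp: unitary_equiv_def)
    let ?n = "fst T"
    have cU: "U \<in> carrier_mat ?n ?n" "V \<in> carrier_mat ?n ?n" using U V by (simp_all add: unitary_mat_def)
    have "V * U * snd R g = snd T g * (V * U)" if g: "g \<in> carrier G" for g
    proof -
      have c: "snd R g \<in> carrier_mat ?n ?n" "snd S g \<in> carrier_mat ?n ?n" "snd T g \<in> carrier_mat ?n ?n"
        using RST g by (auto intro: unitary_irreps_carrier)
      show ?thesis
        using U V g assoc_mult_mat[OF cU(2,1) c(1)] assoc_mult_mat[OF cU(2) c(2) cU(1)]
          assoc_mult_mat[OF c(3) cU(2,1)] by simp
    qed
    then show "(R, T) \<in> unitary_equiv G"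
      using RST unitary_mat_mult[OF V(1) U(1)] by (auto simp: unitary_equiv_def)
  qed
qed

text \<open>Take traces. The scalar is thus real and nonnegative, and it carries the dimension d,
  which allows two dimensions to be compared.\<close>

lemma mult_mat_adjoint_eq_smult_one:
  fixes A :: "complex mat"
  assumes A: "A \<in> carrier_mat d e" and d: "d > 0" and eq: "A * mat_adjoint A = c \<cdot>\<^sub>m 1\<^sub>m d"
  shows "c = complex_of_real ((\<Sum>i<d. \<Sum>j<e. (cmod (A $$ (i, j)))\<^sup>2) / real d)"
proof -
  have "complex_of_real (\<Sum>i<d. \<Sum>j<e. (cmod (A $$ (i, j)))\<^sup>2) = (\<Sum>i<d. (A * mat_adjoint A) $$ (i, i))"
    using A by (simp add: mult_mat_adjoint_index[OF A] complex_norm_square del: of_real_power index_mult_mat)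
  also have "\<dots> = of_nat d * c" unfolding eq by simp
  finally show ?thesis using d by (simp add: field_simps)
qed

text \<open>Both products of an intertwiner with its adjoint are scalar by irreducibility; comparing the
  scalars and then the traces shows that a non-zero intertwiner is a multiple of a unitary matrix.\<close>

theorem schur_intertwiner:
  fixes G :: "'g::topological_space monoid" (structure)
  assumes "group G" and R: "(d, \<rho>) \<in> unitary_irreps G" and S: "(e, \<sigma>) \<in> unitary_irreps G"
    and A: "A \<in> carrier_mat d e"
    and int: "\<And>g. g \<in> carrier G \<Longrightarrow> \<rho> g * A = A * \<sigma> g"
    and ne: "A \<noteq> 0\<^sub>m d e"
  shows "((d, \<rho>), (e, \<sigma>)) \<in> unitary_equiv G"
proof -
  interpret group G by fact
  have uR: "unitary_rep G (d, \<rho>)" "irreducible_rep G (d, \<rho>)" "d > 0"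
    and uS: "unitary_rep G (e, \<sigma>)" "irreducible_rep G (e, \<sigma>)" "e > 0"
    using R S by (auto simp: unitary_irreps_def irreducible_rep_def)
  note cR = unitary_rep_carrier[OF uR(1)] and cS = unitary_rep_carrier[OF uS(1)]
  have A': "mat_adjoint A \<in> carrier_mat e d" using A by simp
  have int': "mat_adjoint A * \<rho> g = \<sigma> g * mat_adjoint A" if g: "g \<in> carrier G" for g
  proof -
    have "mat_adjoint (\<rho> (inv g) * A) = mat_adjoint (A * \<sigma> (inv g))" using int g by simp
    then show ?thesis
      using mat_adjoint_mult[OF cR[of "inv g"] A] mat_adjoint_mult[OF A cS[of "inv g"]] g
      by (simp add: unitary_rep_inv[OF group_axioms uR(1)] unitary_rep_inv[OF group_axioms uS(1)])
  qed
  obtain c where c: "A * mat_adjoint A = c \<cdot>\<^sub>m 1\<^sub>m d"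
  proof (rule irreducible_rep_commutant[OF uR(2) _ cR])
    show "A * mat_adjoint A \<in> carrier_mat d d" using A A' by (rule mult_carrier_mat)
    fix g assume g: "g \<in> carrier G"
    show "\<rho> g * (A * mat_adjoint A) = A * mat_adjoint A * \<rho> g"
      using assoc_mult_mat[OF cR[OF g] A A'] assoc_mult_mat[OF A A' cR[OF g]]
        assoc_mult_mat[OF A cS[OF g] A'] int[OF g] int'[OF g] by simp
  qed
  obtain c' where c': "mat_adjoint A * A = c' \<cdot>\<^sub>m 1\<^sub>m e"
  proof (rule irreducible_rep_commutant[OF uS(2) _ cS])
    show "mat_adjoint A * A \<in> carrier_mat e e" using A' A by (rule mult_carrier_mat)
    fix g assume g: "g \<in> carrier G"
    show "\<sigma> g * (mat_adjoint A * A) = mat_adjoint A * A * \<sigma> g"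
      using assoc_mult_mat[OF cS[OF g] A' A] assoc_mult_mat[OF A' A cS[OF g]]
        assoc_mult_mat[OF A' cR[OF g] A] int[OF g] int'[OF g] by simp
  qed
  obtain i j where ij: "i < d" "j < e" "A $$ (i, j) \<noteq> 0"
    using ne A by (metis carrier_matD eq_matI index_zero_mat)
  \<comment> \<open>Evaluate A A^* A with either pair of factors bracketed first.\<close>
  have "c \<cdot>\<^sub>m A = c' \<cdot>\<^sub>m A"
    using assoc_mult_mat[OF A A' A] c c' A
    by (simp add: mult_smult_distrib[OF A, of _ e] mult_smult_assoc_mat[of _ d d _ e])
  then have "(c \<cdot>\<^sub>m A) $$ (i, j) = (c' \<cdot>\<^sub>m A) $$ (i, j)" by simp
  then have cc': "c = c'" using ij A by simp
  define s where "s = (\<Sum>i<d. \<Sum>j<e. (cmod (A $$ (i, j)))\<^sup>2)"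
  have "s > 0"
    unfolding s_def
    by (rule sum_pos2[of _ i], (simp_all add: ij sum_nonneg)[2], rule sum_pos2[of _ j])
      (use ij in \<open>simp_all add: sum_nonneg\<close>)
  have 1: "c = of_real (s / d)" unfolding s_def by (rule mult_mat_adjoint_eq_smult_one[OF A uR(3) c])
  have "c' = of_real ((\<Sum>i<e. \<Sum>j<d. (cmod (mat_adjoint A $$ (i, j)))\<^sup>2) / e)"
    by (rule mult_mat_adjoint_eq_smult_one[OF A' uS(3)]) (simp add: c')
  also have "(\<Sum>i<e. \<Sum>j<d. (cmod (mat_adjoint A $$ (i, j)))\<^sup>2) = s"
    unfolding s_def using A by (subst sum.swap) simp
  finally have 2: "c' = of_real (s / e)" .
  from 1 2 cc' have "s / d = s / e" using of_real_eq_iff by blast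
  \<comment> \<open>A and its adjoint have the same Hilbert-Schmidt norm, so equal scalars force
    equal dimensions.\<close>
  then have de: "d = e" using \<open>s > 0\<close> uR(3) uS(3) by (simp add: field_simps)
  define t where "t = sqrt (s / d)"
  have t: "t > 0" "of_real t * of_real t = c"
    using \<open>s > 0\<close> uR(3) by (auto simp: t_def 1 simp flip: of_real_mult)
  \<comment> \<open>The adjoint is used because A satisfies \<rho> A = A \<sigma>, while
    \<open>unitary_equiv\<close> asks for U \<rho> = \<sigma> U. The scalar is t^2, so division by t
    makes the matrix unitary.\<close>
  define U where "U = of_real (1 / t) \<cdot>\<^sub>m mat_adjoint A"
  have U: "U \<in> carrier_mat d d" using A' de by (simp add: U_def)
  have "mat_adjoint U = of_real (1 / t) \<cdot>\<^sub>m A"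
    by (rule eq_matI) (use A in \<open>auto simp: U_def\<close>)
  then have "U * mat_adjoint U = of_real (1 / t) \<cdot>\<^sub>m (of_real (1 / t) \<cdot>\<^sub>m (mat_adjoint A * A))"
    using A A' by (simp add: U_def mult_smult_distrib[of _ e d _ e] mult_smult_assoc_mat[of _ e d _ e])
  also have "\<dots> = 1\<^sub>m d"
    unfolding c' cc'[symmetric] t(2)[symmetric] using t(1) de by (intro eq_matI) (auto simp: field_simps)
  finally have "unitary_mat d U" using U by (simp add: unitary_mat_def)
  moreover have "U * \<rho> g = \<sigma> g * U" if g: "g \<in> carrier G" for g
    using int'[OF g] A' cR[OF g] cS[OF g]
    by (simp add: U_def mult_smult_distrib[of _ e e _ d] mult_smult_assoc_mat[of _ e d _ d])
  ultimately show ?thesis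
    using R S de by (auto simp: unitary_equiv_def)
qed

section \<open>Schur orthogonality and Bessel's inequality\<close>

text \<open>Since e_t has squared norm 1 / w_t, the orthogonal projection \<open>g\<close> of f has
  coefficients w_t times the inner products. Both the inner product of f with g and the squared norm
  of g equal the left side \<open>b\<close>, so expanding the nonnegative integral of |f - g|^2
  gives the claim.\<close>

lemma bessel_inequality:
  fixes f :: "'a \<Rightarrow> complex" and e :: "'t \<Rightarrow> 'a \<Rightarrow> complex" and w :: "'t \<Rightarrow> real"
  assumes T: "finite T" and w: "\<And>t. t \<in> T \<Longrightarrow> w t > 0"
    and f2: "integrable M (\<lambda>x. (cmod (f x))\<^sup>2)"
    and fe: "\<And>t. t \<in> T \<Longrightarrow> integrable M (\<lambda>x. f x * cnj (e t x))"
    and ee: "\<And>s t. s \<in> T \<Longrightarrow> t \<in> T \<Longrightarrow> integrable M (\<lambda>x. e s x * cnj (e t x))"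
    and orth: "\<And>s t. s \<in> T \<Longrightarrow> t \<in> T \<Longrightarrow>
      (\<integral>x. e s x * cnj (e t x) \<partial>M) = (if s = t then of_real (1 / w t) else 0)"
  shows "(\<Sum>t\<in>T. w t * (cmod (\<integral>x. f x * cnj (e t x) \<partial>M))\<^sup>2) \<le> (\<integral>x. (cmod (f x))\<^sup>2 \<partial>M)"
proof -
  define c where "c t = (\<integral>x. f x * cnj (e t x) \<partial>M)" for t
  define a where "a t = of_real (w t) * c t" for t
  define g where "g x = (\<Sum>t\<in>T. a t * e t x)" for x
  define b where "b = (\<Sum>t\<in>T. w t * (cmod (c t))\<^sup>2)"
  have fg_eq: "f x * cnj (g x) = (\<Sum>t\<in>T. cnj (a t) * (f x * cnj (e t x)))" for x
    by (simp add: g_def sum_distrib_left mult_ac)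
  have gg_eq: "g x * cnj (g x) = (\<Sum>s\<in>T. \<Sum>t\<in>T. a s * cnj (a t) * (e s x * cnj (e t x)))" for x
    by (simp add: g_def sum_product mult_ac)
  have fg: "integrable M (\<lambda>x. f x * cnj (g x))" and gg: "integrable M (\<lambda>x. g x * cnj (g x))"
    unfolding fg_eq gg_eq using fe ee by (auto intro!: Bochner_Integration.integrable_sum)
  have "(\<integral>x. f x * cnj (g x) \<partial>M) = (\<Sum>t\<in>T. cnj (a t) * c t)"
    unfolding fg_eq using fe by (subst Bochner_Integration.integral_sum) (auto simp: c_def)
  also have "\<dots> = of_real b"
    by (simp add: b_def a_def complex_norm_square mult_ac del: of_real_power)
  finally have 1: "(\<integral>x. f x * cnj (g x) \<partial>M) = of_real b" .
  have "(\<integral>x. g x * cnj (g x) \<partial>M) = (\<Sum>s\<in>T. \<Sum>t\<in>T. a s * cnj (a t) * (if s = t then of_real (1 / w t) else 0))"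
    unfolding gg_eq using ee orth
    by (simp add: Bochner_Integration.integral_sum Bochner_Integration.integrable_sum cong: sum.cong)
  also have "\<dots> = (\<Sum>s\<in>T. a s * cnj (a s) * of_real (1 / w s))"
    using T by (simp add: if_distrib[of "\<lambda>x. _ * x"] sum.delta cong: if_cong)
  also have "\<dots> = of_real b"
    unfolding b_def of_real_sum
  proof (intro sum.cong refl)
    fix s assume "s \<in> T"
    then have "of_real (w s) \<noteq> (0::complex)" using w[of s] by simp
    then show "a s * cnj (a s) * of_real (1 / w s) = of_real (w s * (cmod (c s))\<^sup>2)"
      by (simp add: a_def complex_norm_square del: of_real_power)
  qed
  finally have 2: "(\<integral>x. g x * cnj (g x) \<partial>M) = of_real b" .
  define r where "r x = Re (f x * cnj (g x))" for x
  define q where "q x = Re (g x * cnj (g x))" for x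
  have r: "integrable M r" "(\<integral>x. r x \<partial>M) = b" and q: "integrable M q" "(\<integral>x. q x \<partial>M) = b"
    unfolding r_def q_def by (simp_all only: integrable_Re fg gg integral_Re 1 2 Re_complex_of_real)
  have sq: "(cmod (f x - g x))\<^sup>2 = (cmod (f x))\<^sup>2 - 2 * r x + q x" for x
    unfolding r_def q_def by (simp only: cmod_power2) (simp add: power2_eq_square algebra_simps)
  have "0 \<le> (\<integral>x. (cmod (f x - g x))\<^sup>2 \<partial>M)" by simp
  also have "\<dots> = (\<integral>x. (cmod (f x))\<^sup>2 \<partial>M) - b"
    unfolding sq using f2 r q by simp
  finally show ?thesis by (simp add: b_def c_def)
qed

lemma unitary_irrepsD:
  "R \<in> unitary_irreps G \<Longrightarrow> unitary_rep G R" "R \<in> unitary_irreps G \<Longrightarrow> fst R > 0"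
  by (auto simp: unitary_irreps_def irreducible_rep_def)

section \<open>Orthogonality relations for matrix coefficients\<close>

context haar_group
begin

lemma borel_measurable_coeff [measurable]:
  "unitary_rep G (d, \<rho>) \<Longrightarrow> i < d \<Longrightarrow> j < d \<Longrightarrow> (\<lambda>g. \<rho> g $$ (i, j)) \<in> borel_measurable haar"
  by (intro borel_measurable_continuous_haar) (simp add: unitary_rep_def)

lemma cmod_coeff_le_1:
  assumes "unitary_rep G (d, \<rho>)" "i < d" "j < d" "g \<in> carrier G"
  shows "cmod (\<rho> g $$ (i, j)) \<le> 1"
proof -
  have "(cmod (\<rho> g $$ (i, j)))\<^sup>2 \<le> (\<Sum>l<d. (cmod (\<rho> g $$ (l, j)))\<^sup>2)"
    using assms by (intro member_le_sum) auto
  also have "\<dots> = 1" using assms by (intro unitary_mat_column_norm unitary_rep_unitary)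
  finally show ?thesis using power2_le_imp_le[of _ "1::real"] by simp
qed

lemma integrable_mult_coeff:
  assumes R: "unitary_rep G (d, \<rho>)" "i < d" "j < d" and f: "integrable haar f"
  shows "integrable haar (\<lambda>g. f g * cnj (\<rho> g $$ (i, j)))"
proof (rule Bochner_Integration.integrable_bound[OF f])
  show "AE g in haar. norm (f g * cnj (\<rho> g $$ (i, j))) \<le> norm (f g)"
    using cmod_coeff_le_1[OF R] by (intro AE_I2) (simp add: norm_mult mult_left_le)
  have "(\<lambda>g. cnj (\<rho> g $$ (i, j))) \<in> borel_measurable haar"
    by (rule borel_measurable_continuous_on[OF _ borel_measurable_coeff[OF R]]) (intro continuous_intros)
  then show "(\<lambda>g. f g * cnj (\<rho> g $$ (i, j))) \<in> borel_measurable haar"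
    using borel_measurable_integrable[OF f] by simp
qed

lemma integrable_coeff:
  assumes R: "unitary_rep G (d, \<rho>)" "i < d" "j < d"
  shows "integrable haar (\<lambda>g. \<rho> g $$ (i, j))"
  using cmod_coeff_le_1[OF R] borel_measurable_coeff[OF R]
  by (intro integrable_const_bound[where B = 1]) auto

text \<open>A is the average over G of \<rho>(g) E \<sigma>(g)^*, where E is the matrix unit with
  entry 1 at (j, l). Left invariance of the average makes it an intertwiner.\<close>

lemma coeff_intertwiner:
  assumes R: "unitary_rep G (d, \<rho>)" and S: "unitary_rep G (e, \<sigma>)" and jl: "j < d" "l < e"
    and h: "h \<in> carrier G"
  defines "A \<equiv> mat d e (\<lambda>(i, k). \<integral>g. \<rho> g $$ (i, j) * cnj (\<sigma> g $$ (k, l)) \<partial>haar)"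
  shows "\<rho> h * A = A * \<sigma> h"
proof (rule eq_matI)
  have c: "\<rho> g \<in> carrier_mat d d" "\<sigma> g \<in> carrier_mat e e" if "g \<in> carrier G" for g
    using unitary_rep_carrier R S that by auto
  have A: "A \<in> carrier_mat d e" by (simp add: A_def)
  have int: "integrable haar (\<lambda>g. \<rho> g $$ (i, j) * cnj (\<sigma> g $$ (k, l)))" if "i < d" "k < e" for i k
    using integrable_mult_coeff[OF S that(2) jl(2) integrable_coeff[OF R that(1) jl(1)]] .
  fix i k assume "i < dim_row (A * \<sigma> h)" "k < dim_col (A * \<sigma> h)"
  then have ik: "i < d" "k < e" using c[OF h] by (auto simp: A_def)
  have "(\<rho> h * A) $$ (i, k) = (\<Sum>m<d. \<rho> h $$ (i, m) * A $$ (m, k))"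
    using c[OF h] A ik by (intro index_mult_mat_sum) auto
  also have "\<dots> = (\<Sum>m<d. \<integral>g. \<rho> h $$ (i, m) * (\<rho> g $$ (m, j) * cnj (\<sigma> g $$ (k, l))) \<partial>haar)"
    using ik by (simp add: A_def)
  also have "\<dots> = (\<integral>g. (\<Sum>m<d. \<rho> h $$ (i, m) * (\<rho> g $$ (m, j) * cnj (\<sigma> g $$ (k, l)))) \<partial>haar)"
    using int ik by (subst Bochner_Integration.integral_sum) auto
  also have "\<dots> = (\<integral>g. \<rho> (h \<otimes> g) $$ (i, j) * cnj (\<sigma> g $$ (k, l)) \<partial>haar)"
  proof (intro Bochner_Integration.integral_cong refl)
    fix g assume "g \<in> space haar"
    then have g: "g \<in> carrier G" by simp
    have "\<rho> (h \<otimes> g) $$ (i, j) = (\<Sum>m<d. \<rho> h $$ (i, m) * \<rho> g $$ (m, j))"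
      unfolding unitary_rep_mult[OF R h g] using c[OF h] c[OF g] ik jl by (intro index_mult_mat_sum) auto
    then show "(\<Sum>m<d. \<rho> h $$ (i, m) * (\<rho> g $$ (m, j) * cnj (\<sigma> g $$ (k, l)))) =
        \<rho> (h \<otimes> g) $$ (i, j) * cnj (\<sigma> g $$ (k, l))"
      by (simp add: sum_distrib_right mult.assoc)
  qed
  finally have 1: "(\<rho> h * A) $$ (i, k) = (\<integral>g. \<rho> (h \<otimes> g) $$ (i, j) * cnj (\<sigma> g $$ (k, l)) \<partial>haar)" .
  \<comment> \<open>The integrand of A \<sigma>(h). Translating by h and using \<sigma>(g) =
    \<sigma>(h)^* \<sigma>(hg) contracts the sum over m and produces the integrand already found for
    \<rho>(h) A.\<close>
  define F where "F g = (\<Sum>m<e. \<sigma> h $$ (m, k) * (\<rho> g $$ (i, j) * cnj (\<sigma> g $$ (m, l))))" for g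
  have "(A * \<sigma> h) $$ (i, k) = (\<Sum>m<e. A $$ (i, m) * \<sigma> h $$ (m, k))"
    using c[OF h] A ik by (intro index_mult_mat_sum) auto
  also have "\<dots> = (\<Sum>m<e. \<integral>g. \<sigma> h $$ (m, k) * (\<rho> g $$ (i, j) * cnj (\<sigma> g $$ (m, l))) \<partial>haar)"
    using ik by (simp add: A_def mult.commute)
  also have "\<dots> = (\<integral>g. F g \<partial>haar)"
    unfolding F_def using int ik by (subst Bochner_Integration.integral_sum) auto
  also have "\<dots> = (\<integral>g. F (h \<otimes> g) \<partial>haar)"
    using borel_measurable_integrable[OF int[OF ik(1)]] h
    by (intro integral_haar_left[symmetric]) (auto simp: F_def intro!: borel_measurable_sum borel_measurable_times)
  also have "\<dots> = (\<integral>g. \<rho> (h \<otimes> g) $$ (i, j) * cnj (\<sigma> g $$ (k, l)) \<partial>haar)"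
  proof (intro Bochner_Integration.integral_cong refl)
    fix g assume "g \<in> space haar"
    then have g: "g \<in> carrier G" by simp
    have "\<sigma> g = mat_adjoint (\<sigma> h) * \<sigma> (h \<otimes> g)"
      unfolding unitary_rep_mult[OF S h g]
      by (rule unitary_mat_cancel(2)[OF unitary_rep_unitary[OF S h] c(2)[OF g], symmetric])
    then have "\<sigma> g $$ (k, l) = (mat_adjoint (\<sigma> h) * \<sigma> (h \<otimes> g)) $$ (k, l)" by simp
    also have "\<dots> = (\<Sum>m<e. mat_adjoint (\<sigma> h) $$ (k, m) * \<sigma> (h \<otimes> g) $$ (m, l))"
      using c[OF h] c[of "h \<otimes> g"] g h ik jl by (intro index_mult_mat_sum) auto
    also have "\<dots> = (\<Sum>m<e. cnj (\<sigma> h $$ (m, k)) * \<sigma> (h \<otimes> g) $$ (m, l))"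
      using c[OF h] ik by simp
    finally show "F (h \<otimes> g) = \<rho> (h \<otimes> g) $$ (i, j) * cnj (\<sigma> g $$ (k, l))"
      by (simp add: F_def sum_distrib_left mult_ac)
  qed
  finally show "(\<rho> h * A) $$ (i, k) = (A * \<sigma> h) $$ (i, k)" using 1 by simp
qed (use unitary_rep_carrier[OF R h] unitary_rep_carrier[OF S h] in \<open>auto simp: A_def\<close>)

lemma coeff_orthogonal_inequivalent:
  assumes R: "(d, \<rho>) \<in> unitary_irreps G" and S: "(e, \<sigma>) \<in> unitary_irreps G"
    and ne: "((d, \<rho>), (e, \<sigma>)) \<notin> unitary_equiv G" and "i < d" "j < d" "k < e" "l < e"
  shows "(\<integral>g. \<rho> g $$ (i, j) * cnj (\<sigma> g $$ (k, l)) \<partial>haar) = 0"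
proof -
  define A where "A = mat d e (\<lambda>(i, k). \<integral>g. \<rho> g $$ (i, j) * cnj (\<sigma> g $$ (k, l)) \<partial>haar)"
  have "A = 0\<^sub>m d e"
  proof (rule ccontr)
    assume "A \<noteq> 0\<^sub>m d e"
    moreover have "\<rho> h * A = A * \<sigma> h" if "h \<in> carrier G" for h
      unfolding A_def using R S assms that by (intro coeff_intertwiner) (auto simp: unitary_irreps_def)
    moreover have "A \<in> carrier_mat d e" by (simp add: A_def)
    ultimately show False using schur_intertwiner[OF group_axioms R S] ne by blast
  qed
  then have "A $$ (i, k) = 0" using assms by simp
  then show ?thesis using assms by (simp add: A_def)
qed

text \<open>The averaged matrix is a scalar by irreducibility. Its trace is the integral of the
  inner product of two columns of a unitary matrix, which fixes the scalar as 1/d or 0.\<close>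

lemma coeff_orthonormal:
  assumes R: "(d, \<rho>) \<in> unitary_irreps G" and "i < d" "j < d" "k < d" "l < d"
  shows "(\<integral>g. \<rho> g $$ (i, j) * cnj (\<rho> g $$ (k, l)) \<partial>haar) = (if i = k \<and> j = l then 1 / of_nat d else 0)"
proof -
  have uR: "unitary_rep G (d, \<rho>)" "irreducible_rep G (d, \<rho>)" "d > 0"
    using R by (auto simp: unitary_irreps_def irreducible_rep_def)
  define A where "A = mat d d (\<lambda>(i, k). \<integral>g. \<rho> g $$ (i, j) * cnj (\<rho> g $$ (k, l)) \<partial>haar)"
  obtain c where c: "A = c \<cdot>\<^sub>m 1\<^sub>m d"
  proof (rule irreducible_rep_commutant[OF uR(2) _ unitary_rep_carrier[OF uR(1)]])
    show "A \<in> carrier_mat d d" by (simp add: A_def)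
    show "\<rho> h * A = A * \<rho> h" if "h \<in> carrier G" for h
      unfolding A_def using uR assms that by (intro coeff_intertwiner)
  qed
  have "of_nat d * c = (\<Sum>i<d. A $$ (i, i))" by (simp add: c)
  also have "\<dots> = (\<integral>g. (\<Sum>i<d. \<rho> g $$ (i, j) * cnj (\<rho> g $$ (i, l))) \<partial>haar)"
    using uR assms
    by (subst Bochner_Integration.integral_sum) (auto simp: A_def intro!: integrable_mult_coeff integrable_coeff)
  also have "\<dots> = (\<integral>g. (if j = l then 1 else 0) \<partial>haar)"
  proof (intro Bochner_Integration.integral_cong refl)
    fix g assume "g \<in> space haar"
    then show "(\<Sum>i<d. \<rho> g $$ (i, j) * cnj (\<rho> g $$ (i, l))) = (if j = l then 1 else 0)"
      using unitary_mat_columns[OF unitary_rep_unitary[OF uR(1)], of g l j] assms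
      by (cases "j = l") (simp_all add: mult.commute)
  qed
  also have "\<dots> = (if j = l then 1 else 0)" using emeasure_carrier by (simp add: measure_def)
  finally have "c = (if j = l then 1 / of_nat d else 0)" using uR(3) by (auto simp: field_simps split: if_splits)
  moreover have "(\<integral>g. \<rho> g $$ (i, j) * cnj (\<rho> g $$ (k, l)) \<partial>haar) = A $$ (i, k)"
    using assms by (simp add: A_def)
  ultimately show ?thesis using assms by (auto simp: c)
qed

text \<open>The coefficients of pairwise inequivalent irreducible representations form an orthogonal
  system with squared norms 1/d, which is why d appears as the weight.\<close>

lemma bessel_coeff:
  assumes S: "finite S" "S \<subseteq> unitary_irreps G"
    and ineq: "\<And>R R'. R \<in> S \<Longrightarrow> R' \<in> S \<Longrightarrow> R \<noteq> R' \<Longrightarrow> (R, R') \<notin> unitary_equiv G"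
    and f: "f \<in> borel_measurable haar" and f2: "integrable haar (\<lambda>g. (cmod (f g))\<^sup>2)"
  shows "(\<Sum>(d, \<rho>)\<in>S. d * (\<Sum>i<d. \<Sum>j<d. (cmod (\<integral>g. f g * cnj (\<rho> g $$ (j, i)) \<partial>haar))\<^sup>2))
    \<le> (\<integral>g. (cmod (f g))\<^sup>2 \<partial>haar)"
proof -
  define T where "T = (SIGMA R:S. {..<fst R} \<times> {..<fst R})"
  \<comment> \<open>The indices are transposed because the (i, j) entry of a Fourier coefficient
    pairs f with the conjugate of the (j, i) entry of the representation.\<close>
  define e where "e t g = snd (fst t) g $$ (snd (snd t), fst (snd t))"
    for t :: "'g matrix_rep \<times> nat \<times> nat" and g
  define w where "w t = real (fst (fst t))" for t :: "'g matrix_rep \<times> nat \<times> nat"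
  have T: "finite T" using S by (auto simp: T_def)
  have uR: "unitary_rep G (fst (fst t), snd (fst t))" "fst (fst t) > 0"
    "(fst (fst t), snd (fst t)) \<in> unitary_irreps G" "fst t \<in> S"
    "fst (snd t) < fst (fst t)" "snd (snd t) < fst (fst t)"
    if "t \<in> T" for t
  proof -
    show 1: "fst t \<in> S" "fst (snd t) < fst (fst t)" "snd (snd t) < fst (fst t)"
      using that by (auto simp: T_def)
    then show "(fst (fst t), snd (fst t)) \<in> unitary_irreps G" using S by auto
    from unitary_irrepsD[OF this] show "unitary_rep G (fst (fst t), snd (fst t))" "fst (fst t) > 0" by simp_all
  qed
  have fi: "integrable haar f"
  proof (rule Bochner_Integration.integrable_bound[of _ "\<lambda>g. 1 + (cmod (f g))\<^sup>2"])
    have "cmod (f g) \<le> 1 + (cmod (f g))\<^sup>2" for g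
    proof -
      have "2 * cmod (f g) \<le> 1 + (cmod (f g))\<^sup>2" using sum_squares_bound[of 1 "cmod (f g)"] by simp
      then show ?thesis using norm_ge_zero[of "f g"] by linarith
    qed
    then show "AE g in haar. norm (f g) \<le> norm (1 + (cmod (f g))\<^sup>2)" by simp
  qed (use f f2 in simp_all)
  have "(\<Sum>t\<in>T. w t * (cmod (\<integral>x. f x * cnj (e t x) \<partial>haar))\<^sup>2) \<le> (\<integral>x. (cmod (f x))\<^sup>2 \<partial>haar)"
  proof (rule bessel_inequality[OF T _ f2])
    show "w t > 0" if "t \<in> T" for t using uR[OF that] by (simp add: w_def)
    show "integrable haar (\<lambda>x. f x * cnj (e t x))" if "t \<in> T" for t
      unfolding e_def using uR[OF that] fi by (intro integrable_mult_coeff)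
    show "integrable haar (\<lambda>x. e s x * cnj (e t x))" if "s \<in> T" "t \<in> T" for s t
      unfolding e_def using uR[OF that(1)] uR[OF that(2)]
      by (intro integrable_mult_coeff integrable_coeff)
    show "(\<integral>x. e s x * cnj (e t x) \<partial>haar) = (if s = t then of_real (1 / w t) else 0)"
      if "s \<in> T" "t \<in> T" for s t
    proof (cases "fst s = fst t")
      case True
      then show ?thesis
        using uR(5,6)[OF that(1)] uR(5,6)[OF that(2)]
          coeff_orthonormal[OF uR(3)[OF that(2)], of "snd (snd s)" "fst (snd s)" "snd (snd t)" "fst (snd t)"]
        by (auto simp: e_def w_def prod_eq_iff)
    next
      case False
      have "(\<integral>x. e s x * cnj (e t x) \<partial>haar) = 0"
        unfolding e_def using uR[OF that(1)] uR[OF that(2)] ineq[of "fst s" "fst t"] False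
        by (intro coeff_orthogonal_inequivalent) auto
      then show ?thesis using False by auto
    qed
  qed
  also have "(\<Sum>t\<in>T. w t * (cmod (\<integral>x. f x * cnj (e t x) \<partial>haar))\<^sup>2) =
    (\<Sum>R\<in>S. \<Sum>t\<in>{..<fst R} \<times> {..<fst R}. w (R, t) * (cmod (\<integral>x. f x * cnj (e (R, t) x) \<partial>haar))\<^sup>2)"
    unfolding T_def using S by (subst sum.Sigma) (auto simp: case_prod_unfold)
  also have "\<dots> = (\<Sum>(d, \<rho>)\<in>S. d * (\<Sum>i<d. \<Sum>j<d. (cmod (\<integral>g. f g * cnj (\<rho> g $$ (j, i)) \<partial>haar))\<^sup>2))"
    by (intro sum.cong refl)
      (auto simp: w_def e_def sum_distrib_left sum.cartesian_product case_prod_unfold)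
  finally show ?thesis .
qed

end

section \<open>Fourier coefficients on the coset space\<close>

lemma fixed_vectors_subspace:
  assumes R: "unitary_rep G (d, \<rho>)" and K: "K \<subseteq> carrier G"
  shows "VectorSpace.subspace class_ring (fixed_vectors K (d, \<rho>)) (module_vec TYPE(complex) d)"
proof (rule subspace_module_vecI)
  have c: "\<rho> h \<in> carrier_mat d d" if "h \<in> K" for h
    using unitary_rep_carrier[OF R] K that by blast
  show "0\<^sub>v d \<in> fixed_vectors K (d, \<rho>)"
    by (auto simp: fixed_vectors_def carrier_matD[OF c] scalar_prod_def intro!: eq_vecI)
  show "v + w \<in> fixed_vectors K (d, \<rho>)" if "v \<in> fixed_vectors K (d, \<rho>)" "w \<in> fixed_vectors K (d, \<rho>)" for v w
    using that by (auto simp: fixed_vectors_def mult_add_distrib_mat_vec[OF c])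
  show "a \<cdot>\<^sub>v v \<in> fixed_vectors K (d, \<rho>)" if "v \<in> fixed_vectors K (d, \<rho>)" for a v
    using that by (auto simp: fixed_vectors_def mult_mat_vec[OF c])
qed (auto simp: fixed_vectors_def)

lemma fixed_vectors_adapted_index:
  fixes a :: "complex vec"
  assumes R: "unitary_rep G (d, \<rho>)" and K: "K \<subseteq> carrier G"
    and basis: "vectorspace.basis class_ring (fixed_space K (d, \<rho>)) (unit_vec d ` {..<k})"
    and a: "a \<in> fixed_vectors K (d, \<rho>)" and i: "k \<le> i" "i < d"
  shows "a $ i = 0"
proof -
  interpret vec_space "TYPE(complex)" d .
  let ?W = "fixed_vectors K (d, \<rho>)" and ?E = "unit_vec d ` {..<k} :: complex vec set"
  have sub: "VectorSpace.subspace class_ring ?W V" by (rule fixed_vectors_subspace[OF R K])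
  have sp: "fixed_space K (d, \<rho>) = V\<lparr>carrier := ?W\<rparr>" by (simp add: fixed_space_def)
  have vs: "vectorspace class_ring (V\<lparr>carrier := ?W\<rparr>)" by (rule subspace_is_vs[OF sub])
  have b: "module.span class_ring (V\<lparr>carrier := ?W\<rparr>) ?E = ?W" "?E \<subseteq> ?W"
    using basis unfolding sp vectorspace.basis_def[OF vs] by auto
  \<comment> \<open>The basis property refers to the fixed space as a module of its own. Passing to
    the span in the ambient space allows coordinates to be read off a linear combination.\<close>
  have "span ?E = ?W"
    using span_li_not_depend(1)[OF b(2)] sub b(1) by (simp add: VectorSpace.subspace_def)
  then have "a \<in> span ?E" using a by simp
  then obtain c A where A: "a = lincomb c A" "finite A" "A \<subseteq> ?E"
    unfolding span_def by auto
  have "a $ i = (\<Sum>x\<in>A. c x * x $ i)"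
    unfolding A(1) using A(3) by (intro lincomb_index[OF i(2)]) auto
  also have "\<dots> = 0"
    using A(3) i by (intro sum.neutral) (auto simp: subset_iff)
  finally show ?thesis .
qed

lemma fourier_coeff_carrier: "fourier_coeff G K h f (d, \<rho>) \<in> carrier_mat d d"
  by (simp add: fourier_coeff_def)

lemma fourier_size_eq:
  "fourier_size G K h f (d, \<rho>) =
    sqrt ((\<Sum>i<d. \<Sum>j<d. (cmod (fourier_coeff G K h f (d, \<rho>) $$ (i, j)))\<^sup>2) / fixed_dim K (d, \<rho>))"
proof -
  let ?A = "fourier_coeff G K h f (d, \<rho>)"
  note A = fourier_coeff_carrier[of G K h f d \<rho>]
  have "mat_trace (mat_adjoint ?A * ?A) = (\<Sum>j<d. (mat_adjoint ?A * ?A) $$ (j, j))"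
    using A by (simp add: mat_trace_def del: index_mult_mat(1))
  also have "\<dots> = (\<Sum>j<d. \<Sum>i<d. of_real ((cmod (?A $$ (i, j)))\<^sup>2))"
    using A by (intro sum.cong refl)
      (simp add: adjoint_mult_mat_index[OF A] complex_norm_square mult.commute del: of_real_power index_mult_mat)
  also have "\<dots> = of_real (\<Sum>i<d. \<Sum>j<d. (cmod (?A $$ (i, j)))\<^sup>2)"
    by (subst sum.swap) simp
  finally show ?thesis by (simp add: fourier_size_def)
qed

lemma fourier_size_nonneg: "fourier_size G K h f R \<ge> 0"
  by (cases R) (simp add: fourier_size_eq sum_nonneg)

lemma adapted_bases_irreps:
  assumes "adapted_bases G K b" "\<pi> \<in> class_I_dual G K"
  shows "b \<pi> \<in> unitary_irreps G"
  using assms Union_quotient[OF unitary_equiv_equiv[of G]]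
  by (auto simp: adapted_bases_def class_I_dual_def unitary_dual_def)

section \<open>The two endpoint estimates for Fourier coefficients\<close>

context haar_group
begin

lemma index_fourier_coeff:
  assumes "unitary_rep G (d, \<rho>)" "i < d" "j < d"
  shows "fourier_coeff G K haar f (d, \<rho>) $$ (i, j) = (\<integral>g. f (g <# K) * cnj (\<rho> g $$ (j, i)) \<partial>haar)"
proof -
  have "mat_adjoint (\<rho> g) $$ (i, j) = cnj (\<rho> g $$ (j, i))" if "g \<in> carrier G" for g
    using unitary_rep_carrier[OF assms(1) that] assms by simp
  then show ?thesis
    using assms by (auto simp: fourier_coeff_def intro!: Bochner_Integration.integral_cong)
qed

lemma fourier_size_scale:
  assumes R: "unitary_rep G (d, \<rho>)" and s: "s > 0"
  shows "fourier_size G K haar (\<lambda>x. f x / of_real s) (d, \<rho>) = fourier_size G K haar f (d, \<rho>) / s"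
proof -
  have "fourier_coeff G K haar (\<lambda>x. f x / of_real s) (d, \<rho>) $$ (i, j) =
      fourier_coeff G K haar f (d, \<rho>) $$ (i, j) / of_real s" if "i < d" "j < d" for i j
    using that by (simp add: index_fourier_coeff[OF R])
  then show ?thesis
    using s by (simp add: fourier_size_eq norm_divide power_divide sum_divide_distrib[symmetric] real_sqrt_divide real_sqrt_mult)
qed

lemma fourier_size_add_le:
  assumes R: "unitary_rep G (d, \<rho>)"
    and f: "integrable haar (\<lambda>g. f (g <# K))" and f': "integrable haar (\<lambda>g. f' (g <# K))"
  shows "fourier_size G K haar (\<lambda>x. f x + f' x) (d, \<rho>) \<le>
    fourier_size G K haar f (d, \<rho>) + fourier_size G K haar f' (d, \<rho>)"
proof -
  let ?c = "\<lambda>f (i, j). cmod (fourier_coeff G K haar f (d, \<rho>) $$ (i, j))"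
  let ?T = "{..<d} \<times> {..<d}"
  have eq: "fourier_size G K haar f (d, \<rho>) = L2_set (?c f) ?T / sqrt (fixed_dim K (d, \<rho>))" for f
    by (simp add: fourier_size_eq L2_set_def real_sqrt_divide sum.cartesian_product case_prod_unfold)
  have "L2_set (?c (\<lambda>x. f x + f' x)) ?T \<le> L2_set (\<lambda>t. ?c f t + ?c f' t) ?T"
  proof (rule L2_set_mono)
    fix t assume "t \<in> ?T"
    then obtain i j where t: "t = (i, j)" "i < d" "j < d" by auto
    then have "fourier_coeff G K haar (\<lambda>x. f x + f' x) (d, \<rho>) $$ (i, j) =
        fourier_coeff G K haar f (d, \<rho>) $$ (i, j) + fourier_coeff G K haar f' (d, \<rho>) $$ (i, j)"
      using integrable_mult_coeff[OF R _ _ f] integrable_mult_coeff[OF R _ _ f']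
      by (simp add: index_fourier_coeff[OF R] distrib_right)
    then show "?c (\<lambda>x. f x + f' x) t \<le> ?c f t + ?c f' t"
      using t by (simp add: norm_triangle_ineq)
  qed auto
  also have "\<dots> \<le> L2_set (?c f) ?T + L2_set (?c f') ?T" by (rule L2_set_triangle_ineq)
  finally show ?thesis
    unfolding eq by (simp add: divide_right_mono flip: add_divide_distrib)
qed

text \<open>Duality keeps the dimension out of the constant: pair row i with itself and move the sum
  under the integral. Column i of the unitary matrix has norm 1, so Cauchy-Schwarz gives s^2 \<le> n
  s for the norm s of the row and the L^1 norm n.\<close>

lemma fourier_coeff_row_bound:
  assumes R: "unitary_rep G (d, \<rho>)" and f: "integrable haar (\<lambda>g. f (g <# K))" and i: "i < d"
  shows "(\<Sum>j<d. (cmod (fourier_coeff G K haar f (d, \<rho>) $$ (i, j)))\<^sup>2) \<le>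
    (\<integral>g. cmod (f (g <# K)) \<partial>haar)\<^sup>2"
proof -
  define v where "v j = fourier_coeff G K haar f (d, \<rho>) $$ (i, j)" for j
  define s where "s = L2_set (\<lambda>j. cmod (v j)) {..<d}"
  define n where "n = (\<integral>g. cmod (f (g <# K)) \<partial>haar)"
  have v: "v j = (\<integral>g. f (g <# K) * cnj (\<rho> g $$ (j, i)) \<partial>haar)" if "j < d" for j
    using that i by (simp add: v_def index_fourier_coeff[OF R])
  have int: "integrable haar (\<lambda>g. f (g <# K) * cnj (\<rho> g $$ (j, i)))" if "j < d" for j
    using that i f by (intro integrable_mult_coeff[OF R])
  have s2: "s\<^sup>2 = (\<Sum>j<d. (cmod (v j))\<^sup>2)" by (simp add: s_def L2_set_def sum_nonneg)
  have "complex_of_real (s\<^sup>2) = (\<Sum>j<d. cnj (v j) * v j)"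
    by (simp add: s2 complex_norm_square mult.commute del: of_real_power)
  also have "\<dots> = (\<Sum>j<d. (\<integral>g. cnj (v j) * (f (g <# K) * cnj (\<rho> g $$ (j, i))) \<partial>haar))"
    by (intro sum.cong refl) (simp add: v[symmetric])
  also have "\<dots> = (\<integral>g. (\<Sum>j<d. cnj (v j) * (f (g <# K) * cnj (\<rho> g $$ (j, i)))) \<partial>haar)"
    using int by (subst Bochner_Integration.integral_sum) auto
  finally have "s\<^sup>2 = cmod (\<integral>g. (\<Sum>j<d. cnj (v j) * (f (g <# K) * cnj (\<rho> g $$ (j, i)))) \<partial>haar)"
    by (metis norm_of_real abs_power2)
  also have "\<dots> \<le> (\<integral>g. cmod (f (g <# K)) * s \<partial>haar)"
  proof (rule order_trans[OF integral_norm_bound], rule integral_mono)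
    show "integrable haar (\<lambda>g. norm (\<Sum>j<d. cnj (v j) * (f (g <# K) * cnj (\<rho> g $$ (j, i)))))"
      using int by (intro integrable_norm Bochner_Integration.integrable_sum) auto
    show "integrable haar (\<lambda>g. cmod (f (g <# K)) * s)" using f by simp
    fix g assume "g \<in> space haar"
    then have g: "g \<in> carrier G" by simp
    have "cmod (\<Sum>j<d. cnj (v j) * (f (g <# K) * cnj (\<rho> g $$ (j, i)))) =
        cmod (f (g <# K) * (\<Sum>j<d. cnj (v j) * cnj (\<rho> g $$ (j, i))))"
      by (simp add: sum_distrib_left mult_ac)
    also have "\<dots> = cmod (f (g <# K)) * cmod (\<Sum>j<d. cnj (v j) * cnj (\<rho> g $$ (j, i)))"
      by (rule norm_mult)
    also have "cmod (\<Sum>j<d. cnj (v j) * cnj (\<rho> g $$ (j, i))) \<le> (\<Sum>j<d. \<bar>cmod (v j)\<bar> * \<bar>cmod (\<rho> g $$ (j, i))\<bar>)"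
      by (rule order_trans[OF norm_sum]) (simp add: norm_mult)
    also have "\<dots> \<le> s * L2_set (\<lambda>j. cmod (\<rho> g $$ (j, i))) {..<d}"
      unfolding s_def by (rule L2_set_mult_ineq)
    also have "L2_set (\<lambda>j. cmod (\<rho> g $$ (j, i))) {..<d} = 1"
      using unitary_mat_column_norm[OF unitary_rep_unitary[OF R g] i] by (simp add: L2_set_def)
    finally show "norm (\<Sum>j<d. cnj (v j) * (f (g <# K) * cnj (\<rho> g $$ (j, i)))) \<le> cmod (f (g <# K)) * s"
      by (simp add: mult_left_mono)
  qed
  also have "\<dots> = n * s" by (simp add: n_def)
  finally have "s * s \<le> n * s" by (simp add: power2_eq_square)
  moreover have "s \<ge> 0" by (simp add: s_def L2_set_nonneg)
  moreover have "n \<ge> 0" by (simp add: n_def)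
  ultimately have "s \<le> n" by (cases "s = 0") auto
  then have "s\<^sup>2 \<le> n\<^sup>2" using \<open>s \<ge> 0\<close> by (rule power_mono)
  then show ?thesis by (simp add: s2 v_def n_def)
qed

text \<open>Right translation by \<open>h \<in> K\<close> gives \<open>\<rho>(h) A = A\<close> for the coefficient matrix \<open>A\<close>, so its
  columns are fixed vectors.\<close>

lemma col_fourier_coeff_fixed:
  assumes K: "subgroup K G" and R: "unitary_rep G (d, \<rho>)"
    and f: "integrable haar (\<lambda>g. f (g <# K))" and j: "j < d"
  shows "col (fourier_coeff G K haar f (d, \<rho>)) j \<in> fixed_vectors K (d, \<rho>)"
proof -
  define A where "A = fourier_coeff G K haar f (d, \<rho>)"
  have A: "A \<in> carrier_mat d d" unfolding A_def by (rule fourier_coeff_carrier)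
  have "\<rho> h *\<^sub>v col A j = col A j" if hK: "h \<in> K" for h
  proof (rule eq_vecI)
    have h: "h \<in> carrier G" using subgroup.subset[OF K] hK by blast
    note c = unitary_rep_carrier[OF R]
    fix i assume "i < dim_vec (col A j)"
    then have i: "i < d" using A by simp
    have int: "integrable haar (\<lambda>g. f (g <# K) * cnj (\<rho> g $$ (j, m)))" if "m < d" for m
      using that j f by (intro integrable_mult_coeff[OF R])
    define F where "F g = (\<Sum>m<d. \<rho> h $$ (i, m) * (f (g <# K) * cnj (\<rho> g $$ (j, m))))" for g
    have "(\<rho> h *\<^sub>v col A j) $ i = (\<rho> h * A) $$ (i, j)" using c[OF h] A i j by simp
    also have "\<dots> = (\<Sum>m<d. \<rho> h $$ (i, m) * A $$ (m, j))"
      using c[OF h] A i j by (intro index_mult_mat_sum) auto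
    also have "\<dots> = (\<Sum>m<d. (\<integral>g. \<rho> h $$ (i, m) * (f (g <# K) * cnj (\<rho> g $$ (j, m))) \<partial>haar))"
      using j by (intro sum.cong refl) (simp add: A_def index_fourier_coeff[OF R])
    also have "\<dots> = (\<integral>g. F g \<partial>haar)"
      unfolding F_def using int by (subst Bochner_Integration.integral_sum) auto
    also have "\<dots> = (\<integral>g. F (g \<otimes> h) \<partial>haar)"
      using borel_measurable_integrable[OF int] h
      by (intro integral_haar_right[symmetric]) (auto simp: F_def intro!: borel_measurable_sum borel_measurable_times)
    also have "\<dots> = (\<integral>g. f (g <# K) * cnj (\<rho> g $$ (j, i)) \<partial>haar)"
    proof (intro Bochner_Integration.integral_cong refl)
      fix g assume "g \<in> space haar"
      then have g: "g \<in> carrier G" by simp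
      \<comment> \<open>Multiplying g by h on the right leaves the coset alone, while \<rho>(g) =
        \<rho>(gh) \<rho>(h)^*; this contracts the sum over m in \<open>F\<close>.\<close>
      have coset: "(g \<otimes> h) <# K = g <# K"
        using l_repr_independence[of "g \<otimes> h" g K] K g hK by (auto simp: l_coset_def)
      have "\<rho> (g \<otimes> h) * mat_adjoint (\<rho> h) = \<rho> g * (\<rho> h * mat_adjoint (\<rho> h))"
        unfolding unitary_rep_mult[OF R g h]
        using c[OF g] c[OF h] by (intro assoc_mult_mat) auto
      also have "\<dots> = \<rho> g"
        using unitary_rep_unitary[OF R h] c[OF g] by (simp add: unitary_mat_def)
      finally have "\<rho> g $$ (j, i) = (\<rho> (g \<otimes> h) * mat_adjoint (\<rho> h)) $$ (j, i)" by simp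
      also have "\<dots> = (\<Sum>m<d. \<rho> (g \<otimes> h) $$ (j, m) * mat_adjoint (\<rho> h) $$ (m, i))"
        using c[OF h] c[of "g \<otimes> h"] g h i j by (intro index_mult_mat_sum) auto
      also have "\<dots> = (\<Sum>m<d. \<rho> (g \<otimes> h) $$ (j, m) * cnj (\<rho> h $$ (i, m)))"
        using c[OF h] i by simp
      finally show "F (g \<otimes> h) = f (g <# K) * cnj (\<rho> g $$ (j, i))"
        by (simp add: F_def coset sum_distrib_left mult_ac)
    qed
    also have "\<dots> = col A j $ i" using A i j by (simp add: A_def index_fourier_coeff[OF R])
    finally show "(\<rho> h *\<^sub>v col A j) $ i = col A j $ i" .
  qed (use A unitary_rep_carrier[OF R] subgroup.subset[OF K] hK in auto)
  then show ?thesis using A j by (auto simp: fixed_vectors_def A_def)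
qed

text \<open>Only rows of index below k survive, each with squared norm at most n^2, and division by
  k in the definition of F_f removes their number.\<close>

lemma fourier_size_le_L1:
  assumes K: "subgroup K G" and R: "unitary_rep G (d, \<rho>)"
    and basis: "vectorspace.basis class_ring (fixed_space K (d, \<rho>)) (unit_vec d ` {..<fixed_dim K (d, \<rho>)})"
    and f: "integrable haar (\<lambda>g. f (g <# K))"
  shows "fourier_size G K haar f (d, \<rho>) \<le> (\<integral>g. cmod (f (g <# K)) \<partial>haar)"
proof -
  define k where "k = fixed_dim K (d, \<rho>)"
  define n where "n = (\<integral>g. cmod (f (g <# K)) \<partial>haar)"
  define A where "A = fourier_coeff G K haar f (d, \<rho>)"
  have A: "A \<in> carrier_mat d d" unfolding A_def by (rule fourier_coeff_carrier)
  have n: "n \<ge> 0" by (simp add: n_def)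
  have zero: "A $$ (i, j) = 0" if "k \<le> i" "i < d" "j < d" for i j
    using fixed_vectors_adapted_index[OF R subgroup.subset[OF K] basis col_fourier_coeff_fixed[OF K R f that(3)], of i]
      that A by (simp add: k_def A_def)
  have "(\<Sum>i<d. \<Sum>j<d. (cmod (A $$ (i, j)))\<^sup>2) = (\<Sum>i\<in>{..<d} \<inter> {..<k}. \<Sum>j<d. (cmod (A $$ (i, j)))\<^sup>2)"
  proof (rule sum.mono_neutral_right)
    show "\<forall>i\<in>{..<d} - {..<d} \<inter> {..<k}. (\<Sum>j<d. (cmod (A $$ (i, j)))\<^sup>2) = 0"
    proof
      fix i assume "i \<in> {..<d} - {..<d} \<inter> {..<k}"
      then have "k \<le> i" "i < d" by auto
      then show "(\<Sum>j<d. (cmod (A $$ (i, j)))\<^sup>2) = 0" by (simp add: zero)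
    qed
  qed auto
  also have "\<dots> \<le> (\<Sum>i\<in>{..<d} \<inter> {..<k}. n\<^sup>2)"
    unfolding n_def A_def by (intro sum_mono fourier_coeff_row_bound[OF R f]) auto
  also have "\<dots> \<le> real k * n\<^sup>2"
    using card_mono[of "{..<k}" "{..<d} \<inter> {..<k}"] by (auto intro!: mult_right_mono)
  finally have "(\<Sum>i<d. \<Sum>j<d. (cmod (A $$ (i, j)))\<^sup>2) / k \<le> n\<^sup>2"
    \<comment> \<open>For k = 0 the quotient is 0 by the convention on division by zero.\<close>
    by (cases "k = 0") (auto simp: field_simps)
  then have "sqrt ((\<Sum>i<d. \<Sum>j<d. (cmod (A $$ (i, j)))\<^sup>2) / k) \<le> n"
    using n real_le_lsqrt by (metis real_sqrt_le_iff real_sqrt_unique)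
  then show ?thesis unfolding fourier_size_eq A_def k_def n_def .
qed

text \<open>The k of the weight cancels the 1/k in the square of F_f, leaving d times the squared
  Hilbert-Schmidt norm.\<close>

lemma bessel_fourier_size:
  assumes b: "adapted_bases G K b" and S: "finite S" "S \<subseteq> class_I_dual G K"
    and f: "(\<lambda>g. f (g <# K)) \<in> borel_measurable haar"
    and f2: "integrable haar (\<lambda>g. (cmod (f (g <# K)))\<^sup>2)"
  shows "(\<Sum>\<pi>\<in>S. fixed_dim K (b \<pi>) * fst (b \<pi>) * (fourier_size G K haar f (b \<pi>))\<^sup>2)
    \<le> (\<integral>g. (cmod (f (g <# K)))\<^sup>2 \<partial>haar)"
proof -
  have mem: "b \<pi> \<in> \<pi>" "\<pi> \<in> unitary_irreps G // unitary_equiv G" if "\<pi> \<in> S" for \<pi>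
    using b S that by (auto simp: adapted_bases_def class_I_dual_def unitary_dual_def)
  have irr: "b \<pi> \<in> unitary_irreps G" if "\<pi> \<in> S" for \<pi>
    using adapted_bases_irreps[OF b] S that by blast
  have eq: "\<pi> = \<pi>' \<longleftrightarrow> (b \<pi>, b \<pi>') \<in> unitary_equiv G" if "\<pi> \<in> S" "\<pi>' \<in> S" for \<pi> \<pi>'
    using mem[OF that(1)] mem[OF that(2)] by (intro quotient_eq_iff[OF unitary_equiv_equiv]) auto
  \<comment> \<open>Distinct classes have inequivalent, hence distinct, representatives, so the sum
    over classes becomes a sum over matrix representations.\<close>
  have inj: "inj_on b S"
    by (rule inj_onI) (metis eq)
  let ?B = "\<lambda>R. fst R * (\<Sum>i<fst R. \<Sum>j<fst R. (cmod (\<integral>g. f (g <# K) * cnj (snd R g $$ (j, i)) \<partial>haar))\<^sup>2)"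
  have "(\<Sum>\<pi>\<in>S. fixed_dim K (b \<pi>) * fst (b \<pi>) * (fourier_size G K haar f (b \<pi>))\<^sup>2) \<le> (\<Sum>\<pi>\<in>S. ?B (b \<pi>))"
  proof (rule sum_mono)
    fix \<pi> assume \<pi>: "\<pi> \<in> S"
    obtain d \<rho> where d: "b \<pi> = (d, \<rho>)" by fastforce
    have R: "unitary_rep G (d, \<rho>)" using unitary_irrepsD(1)[OF irr[OF \<pi>]] d by simp
    show "fixed_dim K (b \<pi>) * fst (b \<pi>) * (fourier_size G K haar f (b \<pi>))\<^sup>2 \<le> ?B (b \<pi>)"
      by (cases "fixed_dim K (d, \<rho>) = 0")
        (simp_all add: d fourier_size_eq sum_nonneg index_fourier_coeff[OF R])
  qed
  also have "\<dots> = (\<Sum>R\<in>b ` S. ?B R)" by (simp add: sum.reindex[OF inj])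
  also have "\<dots> \<le> (\<integral>g. (cmod (f (g <# K)))\<^sup>2 \<partial>haar)"
  proof -
    have "b ` S \<subseteq> unitary_irreps G" using irr by blast
    moreover have "(R, R') \<notin> unitary_equiv G" if "R \<in> b ` S" "R' \<in> b ` S" "R \<noteq> R'" for R R'
      using that eq by blast
    ultimately show ?thesis
      using bessel_coeff[of "b ` S", OF _ _ _ f f2] S by (simp add: case_prod_unfold)
  qed
  finally show ?thesis .
qed

end

section \<open>The Hausdorff-Young inequality\<close>

lemma nn_integral_powr_atMost:
  fixes a c :: real
  assumes a: "a > -1" and c: "c \<ge> 0"
  shows "(\<integral>\<^sup>+x. ennreal (x powr a * indicator {0..c} x) \<partial>lborel) = ennreal (c powr (a + 1) / (a + 1))"
proof (rule nn_integral_has_integral_lborel)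
  have "((\<lambda>x. if x \<in> {0..c} then x powr a else 0) has_integral c powr (a + 1) / (a + 1)) UNIV"
    using has_integral_powr_from_0[OF a c] by (simp only: has_integral_restrict_UNIV)
  then show "((\<lambda>x. x powr a * indicator {0..c} x) has_integral c powr (a + 1) / (a + 1)) UNIV"
    by (rule has_integral_eq_rhs[OF has_integral_eq, rotated]) (auto simp: indicator_def)
qed auto

text \<open>Marcinkiewicz interpolation between the types \<open>(1, \<infinity>)\<close> and \<open>(2, 2)\<close>: at height \<open>l\<close> the
  function is truncated at \<open>(2 D / l) powr p\<close>, so that the large part contributes at most \<open>l / 2\<close>.\<close>

theorem marcinkiewicz_L1_L2:
  fixes \<phi> :: "'a \<Rightarrow> real" and F w :: "'s \<Rightarrow> real"
  assumes "sigma_finite_measure M"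
    and meas [measurable]: "\<phi> \<in> borel_measurable M" and nonneg: "\<And>x. \<phi> x \<ge> 0"
    and p: "p > 1" and D: "D > 0"
    and bound: "(\<integral>\<^sup>+x. ennreal (\<phi> x powr (1 + 1 / p)) \<partial>M) \<le> ennreal D"
    and S: "finite S" and w: "\<And>s. s \<in> S \<Longrightarrow> w s \<ge> 0" and F: "\<And>s. s \<in> S \<Longrightarrow> F s \<ge> 0"
    and split: "\<And>h. h > 0 \<Longrightarrow> \<exists>A B. (\<forall>s\<in>S. A s \<ge> 0 \<and> F s \<le> A s + B) \<and>
      ennreal B \<le> (\<integral>\<^sup>+x. ennreal (\<phi> x * indicator {h<..} (\<phi> x)) \<partial>M) \<and>
      ennreal (\<Sum>s\<in>S. w s * (A s)\<^sup>2) \<le> (\<integral>\<^sup>+x. ennreal ((\<phi> x)\<^sup>2 * indicator {..h} (\<phi> x)) \<partial>M)"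
  shows "ennreal (\<Sum>s\<in>S. w s * F s powr (p + 1)) \<le> ennreal (4 * (p + 1) / (p - 1) * (2 * D) powr (p - 1) * D)"
proof -
  interpret M: sigma_finite_measure M by fact
  interpret pair_sigma_finite M lborel ..
  let ?h = "\<lambda>l. (2 * D / l) powr p"
  have level: "ennreal (\<Sum>s\<in>S. w s * indicator {0..F s} l) \<le>
      ennreal (4 / l\<^sup>2) * (\<integral>\<^sup>+x. ennreal ((\<phi> x)\<^sup>2 * indicator {..?h l} (\<phi> x)) \<partial>M)" if l: "l > 0" for l
  proof -
    have h: "?h l > 0" using l D by simp
    obtain A B where AB: "\<And>s. s \<in> S \<Longrightarrow> A s \<ge> 0" "\<And>s. s \<in> S \<Longrightarrow> F s \<le> A s + B"
      and B: "ennreal B \<le> (\<integral>\<^sup>+x. ennreal (\<phi> x * indicator {?h l<..} (\<phi> x)) \<partial>M)"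
      and A: "ennreal (\<Sum>s\<in>S. w s * (A s)\<^sup>2) \<le> (\<integral>\<^sup>+x. ennreal ((\<phi> x)\<^sup>2 * indicator {..?h l} (\<phi> x)) \<partial>M)"
      using split[OF h] by blast
    \<comment> \<open>Above the truncation height, \<phi>^(1/p) exceeds 2 D / l. The large part is
      therefore dominated by l / (2 D) times the q'-th power, whose integral is at most D.\<close>
    have "\<phi> x * indicator {?h l<..} (\<phi> x) \<le> l / (2 * D) * \<phi> x powr (1 + 1 / p)" for x
    proof (cases "\<phi> x > ?h l")
      case True
      have "2 * D / l = ?h l powr (1 / p)" using p l D by (simp add: powr_powr)
      also have "\<dots> \<le> \<phi> x powr (1 / p)" using True p h by (intro powr_mono2) auto
      finally have "1 \<le> l / (2 * D) * \<phi> x powr (1 / p)" using l D by (simp add: field_simps)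
      then have "\<phi> x * 1 \<le> \<phi> x * (l / (2 * D) * \<phi> x powr (1 / p))" using nonneg by (intro mult_left_mono)
      then show ?thesis using True h nonneg[of x] by (simp add: powr_add mult_ac)
    qed (use l D in auto)
    then have "(\<integral>\<^sup>+x. ennreal (\<phi> x * indicator {?h l<..} (\<phi> x)) \<partial>M) \<le>
        (\<integral>\<^sup>+x. ennreal (l / (2 * D)) * ennreal (\<phi> x powr (1 + 1 / p)) \<partial>M)"
      using l D by (intro nn_integral_mono) (simp flip: ennreal_mult)
    also have "\<dots> = ennreal (l / (2 * D)) * (\<integral>\<^sup>+x. ennreal (\<phi> x powr (1 + 1 / p)) \<partial>M)"
      by (rule nn_integral_cmult) simp
    also have "\<dots> \<le> ennreal (l / (2 * D)) * ennreal D" by (intro mult_left_mono bound) simp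
    also have "\<dots> = ennreal (l / 2)" using l D by (simp flip: ennreal_mult)
    finally have "ennreal B \<le> ennreal (l / 2)" using B by (rule order_trans[rotated])
    then have B': "B \<le> l / 2" using l by (simp add: ennreal_le_iff2)
    \<comment> \<open>Chebyshev's inequality: if F s reaches the level l while B takes at most l/2,
      then A s is at least l/2.\<close>
    have "w s * indicator {0..F s} l \<le> 4 / l\<^sup>2 * (w s * (A s)\<^sup>2)" if s: "s \<in> S" for s
    proof (cases "l \<le> F s")
      case True
      then have "l / 2 \<le> A s" using AB[OF s] B' by simp
      then have "(l / 2)\<^sup>2 \<le> (A s)\<^sup>2" using l by (intro power_mono) auto
      then have "1 \<le> 4 / l\<^sup>2 * (A s)\<^sup>2" using l by (simp add: field_simps)
      then have "w s * 1 \<le> w s * (4 / l\<^sup>2 * (A s)\<^sup>2)" using w[OF s] by (intro mult_left_mono)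
      then show ?thesis using True l by (simp add: mult_ac)
    qed (use w[OF s] in auto)
    then have "(\<Sum>s\<in>S. w s * indicator {0..F s} l) \<le> 4 / l\<^sup>2 * (\<Sum>s\<in>S. w s * (A s)\<^sup>2)"
      unfolding sum_distrib_left by (rule sum_mono)
    then have "ennreal (\<Sum>s\<in>S. w s * indicator {0..F s} l) \<le> ennreal (4 / l\<^sup>2) * ennreal (\<Sum>s\<in>S. w s * (A s)\<^sup>2)"
      using w by (simp add: ennreal_leI sum_nonneg flip: ennreal_mult)
    also have "\<dots> \<le> ennreal (4 / l\<^sup>2) * (\<integral>\<^sup>+x. ennreal ((\<phi> x)\<^sup>2 * indicator {..?h l} (\<phi> x)) \<partial>M)"
      by (intro mult_left_mono A) simp
    finally show ?thesis .
  qed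
  let ?q = "p + 1"
  \<comment> \<open>The layer-cake formula: F^(p+1) is the integral of (p+1) l^p over the levels l
    up to F.\<close>
  have layer: "ennreal (w s * F s powr ?q) =
      (\<integral>\<^sup>+l. ennreal (?q * l powr p * (w s * indicator {0..F s} l)) \<partial>lborel)" if s: "s \<in> S" for s
  proof -
    have "(\<integral>\<^sup>+l. ennreal (?q * l powr p * (w s * indicator {0..F s} l)) \<partial>lborel) =
        (\<integral>\<^sup>+l. ennreal (?q * w s) * ennreal (l powr p * indicator {0..F s} l) \<partial>lborel)"
      using p w[OF s] by (intro nn_integral_cong) (simp add: mult_ac flip: ennreal_mult)
    also have "\<dots> = ennreal (?q * w s) * ennreal (F s powr ?q / ?q)"
      using p F[OF s] by (subst nn_integral_cmult) (auto simp: nn_integral_powr_atMost)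
    also have "\<dots> = ennreal (w s * F s powr ?q)"
      using p w[OF s] by (simp flip: ennreal_mult)
    finally show ?thesis by simp
  qed
  \<comment> \<open>The level estimate multiplied by the layer-cake density, as a jointly measurable
    kernel. The indicator of nonnegative l discards the values of \<open>powr\<close> at negative
    arguments.\<close>
  define k where "k x l = ennreal (4 * ?q * (\<phi> x)\<^sup>2 * (l powr (p - 2) * indicator {0..} l) * indicator {..?h l} (\<phi> x))" for x l
  have [measurable]: "(\<lambda>(x, l). k x l) \<in> borel_measurable (M \<Otimes>\<^sub>M lborel)"
    unfolding k_def indicator_def atMost_iff by measurable
  have "ennreal (\<Sum>s\<in>S. w s * F s powr ?q) = (\<Sum>s\<in>S. ennreal (w s * F s powr ?q))"
    using w by (intro sum_ennreal[symmetric]) simp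
  also have "\<dots> = (\<integral>\<^sup>+l. (\<Sum>s\<in>S. ennreal (?q * l powr p * (w s * indicator {0..F s} l))) \<partial>lborel)"
    by (subst nn_integral_sum) (auto simp: layer)
  also have "\<dots> \<le> (\<integral>\<^sup>+l. (\<integral>\<^sup>+x. k x l \<partial>M) \<partial>lborel)"
  proof (rule nn_integral_mono)
    fix l :: real
    have eq: "(\<Sum>s\<in>S. ennreal (?q * l powr p * (w s * indicator {0..F s} l))) =
        ennreal (?q * l powr p) * ennreal (\<Sum>s\<in>S. w s * indicator {0..F s} l)"
      using p w by (subst sum_ennreal) (auto simp: sum_distrib_left sum_nonneg simp flip: ennreal_mult)
    show "(\<Sum>s\<in>S. ennreal (?q * l powr p * (w s * indicator {0..F s} l))) \<le> (\<integral>\<^sup>+x. k x l \<partial>M)"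
    proof (cases "l > 0")
      case True
      have "ennreal (?q * l powr p) * ennreal (\<Sum>s\<in>S. w s * indicator {0..F s} l) \<le>
          ennreal (?q * l powr p) * (ennreal (4 / l\<^sup>2) * (\<integral>\<^sup>+x. ennreal ((\<phi> x)\<^sup>2 * indicator {..?h l} (\<phi> x)) \<partial>M))"
        by (intro mult_left_mono level True) simp
      also have "\<dots> = (\<integral>\<^sup>+x. ennreal (?q * l powr p * (4 / l\<^sup>2)) * ennreal ((\<phi> x)\<^sup>2 * indicator {..?h l} (\<phi> x)) \<partial>M)"
      proof -
        have "ennreal (?q * l powr p * (4 / l\<^sup>2)) = ennreal (?q * l powr p) * ennreal (4 / l\<^sup>2)"
          using p by (intro ennreal_mult) auto
        then show ?thesis by (subst nn_integral_cmult) (simp_all only: mult.assoc, measurable)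
      qed
      also have "\<dots> = (\<integral>\<^sup>+x. k x l \<partial>M)"
      proof (intro nn_integral_cong)
        fix x
        have "l powr p = l powr (p - 2) * l\<^sup>2"
          using True powr_add[of l "p - 2" 2] by (simp add: powr_numeral)
        then have "?q * l powr p * (4 / l\<^sup>2) = 4 * ?q * l powr (p - 2)" using True by simp
        then show "ennreal (?q * l powr p * (4 / l\<^sup>2)) * ennreal ((\<phi> x)\<^sup>2 * indicator {..?h l} (\<phi> x)) = k x l"
          using True p by (simp add: k_def mult_ac flip: ennreal_mult)
      qed
      finally show ?thesis using eq by simp
    next
      case False
      then have "ennreal (?q * l powr p * (w s * indicator {0..F s} l)) = 0" for s
        using p by (cases "l = 0") auto
      then show ?thesis by simp
    qed
  qed
  also have "\<dots> = (\<integral>\<^sup>+x. (\<integral>\<^sup>+l. k x l \<partial>lborel) \<partial>M)"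
    using Fubini[of "\<lambda>(x, l). k x l"] by simp
  also have "\<dots> \<le> (\<integral>\<^sup>+x. ennreal (4 * ?q / (p - 1) * (2 * D) powr (p - 1)) * ennreal (\<phi> x powr (1 + 1 / p)) \<partial>M)"
  proof (rule nn_integral_mono)
    fix x
    show "(\<integral>\<^sup>+l. k x l \<partial>lborel) \<le> ennreal (4 * ?q / (p - 1) * (2 * D) powr (p - 1)) * ennreal (\<phi> x powr (1 + 1 / p))"
    proof (cases "\<phi> x = 0")
      case False
      then have pos: "\<phi> x > 0" using nonneg[of x] by simp
      \<comment> \<open>For positive l, the truncation condition on \<phi>(x) is the same as l \<le>
        a. The l-integral thus becomes the integral of l^(p-2) over [0, a], which converges since p
        > 1.\<close>
      define a where "a = 2 * D * \<phi> x powr (- 1 / p)"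
      have a: "a \<ge> 0" using D by (simp add: a_def)
      have "k x l \<le> ennreal (4 * ?q * (\<phi> x)\<^sup>2) * ennreal (l powr (p - 2) * indicator {0..a} l)" for l
      proof (cases "l > 0 \<and> \<phi> x \<le> ?h l")
        case True
        have "\<phi> x powr (1 / p) \<le> ?h l powr (1 / p)" using True p pos by (intro powr_mono2) auto
        also have "\<dots> = 2 * D / l" using p True D by (simp add: powr_powr)
        finally have "l \<le> a" using True pos by (simp add: a_def field_simps powr_minus)
        then show ?thesis using True p by (simp add: k_def flip: ennreal_mult)
      next
        case False
        then have "k x l = 0" by (cases "l = 0") (auto simp: k_def)
        then show ?thesis by simp
      qed
      then have "(\<integral>\<^sup>+l. k x l \<partial>lborel) \<le>
          (\<integral>\<^sup>+l. ennreal (4 * ?q * (\<phi> x)\<^sup>2) * ennreal (l powr (p - 2) * indicator {0..a} l) \<partial>lborel)"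
        by (intro nn_integral_mono)
      also have "\<dots> = ennreal (4 * ?q * (\<phi> x)\<^sup>2) * ennreal (a powr (p - 1) / (p - 1))"
        using p nn_integral_powr_atMost[of "p - 2" a, OF _ a] by (subst nn_integral_cmult) auto
      also have "\<dots> = ennreal (4 * ?q * (\<phi> x)\<^sup>2 * (a powr (p - 1) / (p - 1)))"
        using p by (intro ennreal_mult[symmetric]) auto
      also have "4 * ?q * (\<phi> x)\<^sup>2 * (a powr (p - 1) / (p - 1)) =
          4 * ?q / (p - 1) * (2 * D) powr (p - 1) * \<phi> x powr (1 + 1 / p)"
      proof -
        have e1: "a powr (p - 1) = (2 * D) powr (p - 1) * \<phi> x powr (- 1 / p * (p - 1))"
          using D by (simp add: a_def powr_mult powr_powr)
        have "\<phi> x powr 2 = (\<phi> x)\<^sup>2" using pos by simp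
        then have e2: "(\<phi> x)\<^sup>2 * \<phi> x powr (- 1 / p * (p - 1)) = \<phi> x powr (2 + - 1 / p * (p - 1))"
          by (simp only: powr_add)
        \<comment> \<open>The exponent closes up: after integration over l the kernel is again the
          q'-th power of \<phi>.\<close>
        have e3: "2 + - 1 / p * (p - 1) = 1 + 1 / p" using p by (simp add: field_simps)
        have "4 * ?q * (\<phi> x)\<^sup>2 * (a powr (p - 1) / (p - 1)) =
            4 * ?q / (p - 1) * (2 * D) powr (p - 1) * ((\<phi> x)\<^sup>2 * \<phi> x powr (- 1 / p * (p - 1)))"
          by (simp only: e1) simp
        then show ?thesis by (simp only: e2 e3)
      qed
      also have "ennreal (4 * ?q / (p - 1) * (2 * D) powr (p - 1) * \<phi> x powr (1 + 1 / p)) =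
          ennreal (4 * ?q / (p - 1) * (2 * D) powr (p - 1)) * ennreal (\<phi> x powr (1 + 1 / p))"
        using p by (intro ennreal_mult) auto
      finally show ?thesis .
    qed (simp add: k_def)
  qed
  also have "\<dots> = ennreal (4 * ?q / (p - 1) * (2 * D) powr (p - 1)) * (\<integral>\<^sup>+x. ennreal (\<phi> x powr (1 + 1 / p)) \<partial>M)"
    by (rule nn_integral_cmult) simp
  also have "\<dots> \<le> ennreal (4 * ?q / (p - 1) * (2 * D) powr (p - 1)) * ennreal D"
    by (intro mult_left_mono bound) simp
  also have "\<dots> = ennreal (4 * ?q / (p - 1) * (2 * D) powr (p - 1) * D)"
    using p D by (intro ennreal_mult[symmetric]) auto
  finally show ?thesis .
qed

context haar_group
begin

text \<open>Pointwise t \<le> 1 + t^(1 + 1/p), and the total mass is 1.\<close>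

lemma L1_le_one_plus_powr:
  fixes f :: "'g \<Rightarrow> complex"
  assumes [measurable]: "f \<in> borel_measurable haar"
    and bound: "(\<integral>\<^sup>+g. ennreal (cmod (f g) powr (1 + 1 / p)) \<partial>haar) \<le> ennreal D" and "p > 0" "D \<ge> 0"
  shows "integrable haar f" "(\<integral>g. cmod (f g) \<partial>haar) \<le> 1 + D"
proof -
  have "cmod z \<le> 1 + cmod z powr (1 + 1 / p)" for z
  proof (cases "cmod z \<le> 1")
    case False
    then have "cmod z powr 1 \<le> cmod z powr (1 + 1 / p)" using \<open>p > 0\<close> by (intro powr_mono) auto
    then show ?thesis using False by simp
  qed (simp add: add_increasing2)
  then have "(\<integral>\<^sup>+g. ennreal (cmod (f g)) \<partial>haar) \<le> (\<integral>\<^sup>+g. 1 + ennreal (cmod (f g) powr (1 + 1 / p)) \<partial>haar)"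
    by (intro nn_integral_mono) (simp flip: ennreal_1 ennreal_plus)
  also have "\<dots> = 1 + (\<integral>\<^sup>+g. ennreal (cmod (f g) powr (1 + 1 / p)) \<partial>haar)"
    by (subst nn_integral_add) auto
  also have "\<dots> \<le> 1 + ennreal D" by (intro add_left_mono bound)
  finally have le: "(\<integral>\<^sup>+g. ennreal (cmod (f g)) \<partial>haar) \<le> ennreal (1 + D)"
    using \<open>D \<ge> 0\<close> by (simp add: ennreal_plus)
  show int: "integrable haar f"
    using order.strict_trans1[OF le ennreal_less_top] by (intro integrableI_bounded) auto
  show "(\<integral>g. cmod (f g) \<partial>haar) \<le> 1 + D"
  proof (rule ennreal_le_iff[THEN iffD1])
    show "ennreal (\<integral>g. cmod (f g) \<partial>haar) \<le> ennreal (1 + D)"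
      using le nn_integral_eq_integral[of haar "\<lambda>g. cmod (f g)"] int by (simp del: ennreal_plus)
  qed (use \<open>D \<ge> 0\<close> in simp)
qed

text \<open>For p = 1 the exponent q is 2 and the claim is Bessel's inequality. For p > 1 each
  truncation height splits f into a bounded part, square integrable on a probability space, and an
  integrable part, whose contribution to F_f is bounded uniformly in \<pi>.\<close>

lemma hausdorff_young:
  assumes K: "subgroup K G" and b: "adapted_bases G K b" and p: "p \<ge> 1" and D: "D > 0"
    and meas [measurable]: "(\<lambda>g. f (g <# K)) \<in> borel_measurable haar"
    and bound: "(\<integral>\<^sup>+g. ennreal (cmod (f (g <# K)) powr (1 + 1 / p)) \<partial>haar) \<le> ennreal D"
    and S: "finite S" "S \<subseteq> class_I_dual G K"
  shows "(\<Sum>\<pi>\<in>S. fixed_dim K (b \<pi>) * fst (b \<pi>) * fourier_size G K haar f (b \<pi>) powr (p + 1))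
    \<le> (if p = 1 then D else 4 * (p + 1) / (p - 1) * (2 * D) powr (p - 1) * D)" (is "_ \<le> ?C")
proof (cases "p = 1")
  case True
  have pw: "ennreal (cmod (f (g <# K)) powr (1 + 1 / p)) = ennreal ((cmod (f (g <# K)))\<^sup>2)" for g
    using True by simp
  have nn: "(\<integral>\<^sup>+g. ennreal ((cmod (f (g <# K)))\<^sup>2) \<partial>haar) \<le> ennreal D"
    using bound unfolding pw .
  then have int: "integrable haar (\<lambda>g. (cmod (f (g <# K)))\<^sup>2)"
    by (intro integrableI_bounded) (auto simp: less_top[symmetric] top_unique)
  have "(\<Sum>\<pi>\<in>S. fixed_dim K (b \<pi>) * fst (b \<pi>) * fourier_size G K haar f (b \<pi>) powr (p + 1))
      \<le> (\<integral>g. (cmod (f (g <# K)))\<^sup>2 \<partial>haar)"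
    using bessel_fourier_size[OF b S meas int] True by (simp add: fourier_size_nonneg)
  also have "\<dots> \<le> D"
    using nn nn_integral_eq_integral[OF int] D by simp
  finally show ?thesis using True by simp
next
  case False
  then have p1: "p > 1" using p by simp
  let ?w = "\<lambda>\<pi>. real (fixed_dim K (b \<pi>)) * real (fst (b \<pi>))"
  have int: "integrable haar (\<lambda>g. f (g <# K))"
    using L1_le_one_plus_powr[OF meas bound] p D by simp
  have "ennreal (\<Sum>\<pi>\<in>S. ?w \<pi> * fourier_size G K haar f (b \<pi>) powr (p + 1)) \<le>
    ennreal (4 * (p + 1) / (p - 1) * (2 * D) powr (p - 1) * D)"
  proof (rule marcinkiewicz_L1_L2[OF _ _ _ p1 D bound S(1)])
    fix h :: real assume h: "h > 0"
    define f1 where "f1 x = (if cmod (f x) \<le> h then f x else 0)" for x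
    define f2 where "f2 x = (if cmod (f x) \<le> h then 0 else f x)" for x
    define A where "A \<pi> = fourier_size G K haar f1 (b \<pi>)" for \<pi>
    define B where "B = (\<integral>g. cmod (f2 (g <# K)) \<partial>haar)"
    have f12: "(\<lambda>x. f1 x + f2 x) = f" by (auto simp: f1_def f2_def)
    have m [measurable]: "(\<lambda>g. f1 (g <# K)) \<in> borel_measurable haar" "(\<lambda>g. f2 (g <# K)) \<in> borel_measurable haar"
      unfolding f1_def f2_def by measurable
    have i: "integrable haar (\<lambda>g. f1 (g <# K))" "integrable haar (\<lambda>g. f2 (g <# K))"
      by (rule Bochner_Integration.integrable_bound[OF int]; simp add: f1_def f2_def)+
    have i2: "integrable haar (\<lambda>g. (cmod (f1 (g <# K)))\<^sup>2)"
      using h by (intro integrable_const_bound[where B = "h\<^sup>2"]) (auto simp: f1_def intro!: power_mono)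
    have "A \<pi> \<ge> 0 \<and> fourier_size G K haar f (b \<pi>) \<le> A \<pi> + B" if \<pi>: "\<pi> \<in> S" for \<pi>
    proof -
      obtain d \<rho> where d: "b \<pi> = (d, \<rho>)" by fastforce
      have R: "unitary_rep G (d, \<rho>)"
        using unitary_irrepsD(1)[OF adapted_bases_irreps[OF b]] S \<pi> d by (metis subsetD)
      have basis: "vectorspace.basis class_ring (fixed_space K (d, \<rho>)) (unit_vec d ` {..<fixed_dim K (d, \<rho>)})"
        using b S \<pi> d unfolding adapted_bases_def by (metis fst_conv subsetD)
      show ?thesis
        using fourier_size_add_le[OF R i] fourier_size_le_L1[OF K R basis i(2)]
        by (simp add: A_def B_def d f12 fourier_size_nonneg)
    qed
    moreover have "ennreal B = (\<integral>\<^sup>+g. ennreal (cmod (f2 (g <# K))) \<partial>haar)"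
      unfolding B_def using i(2) by (intro nn_integral_eq_integral[symmetric]) auto
    then have "ennreal B \<le> (\<integral>\<^sup>+g. ennreal (cmod (f (g <# K)) * indicator {h<..} (cmod (f (g <# K)))) \<partial>haar)"
      by (auto simp: f2_def intro!: nn_integral_mono)
    moreover have "ennreal (\<Sum>\<pi>\<in>S. ?w \<pi> * (A \<pi>)\<^sup>2) \<le> ennreal (\<integral>g. (cmod (f1 (g <# K)))\<^sup>2 \<partial>haar)"
      using bessel_fourier_size[OF b S m(1) i2] by (intro ennreal_leI) (simp add: A_def)
    moreover have "ennreal (\<integral>g. (cmod (f1 (g <# K)))\<^sup>2 \<partial>haar) = (\<integral>\<^sup>+g. ennreal ((cmod (f1 (g <# K)))\<^sup>2) \<partial>haar)"
      using i2 by (intro nn_integral_eq_integral[symmetric]) auto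
    moreover have "\<dots> \<le> (\<integral>\<^sup>+g. ennreal ((cmod (f (g <# K)))\<^sup>2 * indicator {..h} (cmod (f (g <# K)))) \<partial>haar)"
      by (auto simp: f1_def intro!: nn_integral_mono)
    ultimately show "\<exists>A B. (\<forall>\<pi>\<in>S. A \<pi> \<ge> 0 \<and> fourier_size G K haar f (b \<pi>) \<le> A \<pi> + B) \<and>
        ennreal B \<le> (\<integral>\<^sup>+g. ennreal (cmod (f (g <# K)) * indicator {h<..} (cmod (f (g <# K)))) \<partial>haar) \<and>
        ennreal (\<Sum>\<pi>\<in>S. ?w \<pi> * (A \<pi>)\<^sup>2) \<le>
          (\<integral>\<^sup>+g. ennreal ((cmod (f (g <# K)))\<^sup>2 * indicator {..h} (cmod (f (g <# K)))) \<partial>haar)"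
      by (intro exI[where x = A] exI[where x = B]) auto
  qed (auto simp: fourier_size_nonneg intro: sigma_finite_measure_axioms)
  then show ?thesis
    using False p1 D by (subst (asm) ennreal_le_iff) auto
qed

end

section \<open>From power estimates to Orlicz norms\<close>

theorem theorem3p2:
  fixes G :: "'g::{second_countable_topology,t2_space} monoid"
    and \<A> :: "('g set \<times> ('g \<Rightarrow> 'e::real_normed_vector)) set"
    and K :: "'g set"
    and haar :: "'g measure"
    and \<mu> :: "'g set measure"
    and b :: "'g matrix_rep set \<Rightarrow> 'g matrix_rep"
    and \<Phi> \<Psi> :: "real \<Rightarrow> ennreal"
    and p c\<^sub>0 :: real
  assumes "lie_group G \<A>" and "compact (carrier G)"
    and "subgroup K G" and "closedin (top_of_set (carrier G)) K"
    and "normalized_haar G haar"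
    and "invariant_prob_measure G K \<mu>"
    and "adapted_bases G K b"
    and "complementary_pair \<Phi> \<Psi>" and "\<Phi> 1 + \<Psi> 1 = 1"
    and "continuous_on {0..} \<Phi>" and "continuous_on {0..} \<Psi>"
    and "\<Phi> \<prec>\<^sub>Y (\<lambda>t. ennreal (t\<^sup>2 / 2))"
    and "p \<ge> 1" and "c\<^sub>0 > 0" and "deriv_bounded_by \<Psi> (\<lambda>t. c\<^sub>0 * t powr p)"
  shows "\<exists>r\<^sub>0::real. r\<^sub>0 \<ge> 1 \<and>
    (\<forall>f\<in>orlicz_space \<Phi> \<mu>.
       dual_orlicz_norm G K b \<Psi> (\<lambda>\<pi>. fourier_size G K haar f (b \<pi>))
         \<le> ennreal r\<^sub>0 * orlicz_norm \<Phi> \<mu> f)"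
proof -
  have "radon_measure_on (top_of_set (carrier G)) haar" and haar: "emeasure haar (space haar) = 1"
    "\<And>g A. g \<in> carrier G \<Longrightarrow> A \<in> sets haar \<Longrightarrow> emeasure haar (g <#\<^bsub>G\<^esub> A) = emeasure haar A"
    using assms(5) unfolding normalized_haar_def by blast+
  then have "sets haar = sigma_sets (topspace (top_of_set (carrier G))) {U. openin (top_of_set (carrier G)) U}"
    unfolding radon_measure_on_def by blast
  then have sets: "sets haar = sets (restrict_space borel (carrier G))"
    by (simp add: sets_restrict_space_eq_sigma_sets_openin)
  have G: "group G" "continuous_on (carrier G \<times> carrier G) (\<lambda>(x, y). x \<otimes>\<^bsub>G\<^esub> y)"
    "continuous_on (carrier G) (\<lambda>x. inv\<^bsub>G\<^esub> x)"
    using assms(1) by (simp_all add: lie_group_def)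
  interpret haar_group G haar
  proof (intro haar_group.intro haar_group_axioms.intro)
    show "finite_measure haar" by (rule finite_measureI) (simp add: haar(1))
  qed (use haar sets G in auto)
  note K = assms(3) and b = assms(7) and pair = assms(8) and p = assms(13)
  have q [measurable]: "(\<lambda>g. g <#\<^bsub>G\<^esub> K) \<in> haar \<rightarrow>\<^sub>M \<mu>" and distr: "distr haar \<mu> (\<lambda>g. g <#\<^bsub>G\<^esub> K) = \<mu>"
    using distr_haar_coset[OF K assms(6)] by auto
  have transfer: "(\<integral>\<^sup>+x. h x \<partial>\<mu>) = (\<integral>\<^sup>+g. h (g <#\<^bsub>G\<^esub> K) \<partial>haar)" if "h \<in> borel_measurable \<mu>" for h :: "'g set \<Rightarrow> ennreal"
    by (subst distr[symmetric]) (simp add: nn_integral_distr[OF q] that)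
  have Y: "young_function \<Psi>" using pair by (simp add: complementary_pair_def)
  \<comment> \<open>\<open>c\<close> is the constant in the growth bound for \<open>\<Psi>\<close>;
    \<open>D\<close> below is the constant that Young's inequality derives from it.\<close>
  define c where "c = c\<^sub>0 * 2 powr p"
  have c: "c > 0" using assms(14) by (simp add: c_def)
  have \<Psi>: "\<Psi> y \<le> ennreal (c * y powr (p + 1))" if "y \<ge> 0" for y
    unfolding c_def using assms(14) p that by (intro young_function_le_powr[OF Y assms(11) _ _ assms(15)]) auto
  define D where "D = 2 * (2 * c) powr (1 / p)"
  have D: "D > 0" using c by (simp add: D_def)
  have \<Phi>: "ennreal (x powr (1 + 1 / p)) \<le> ennreal D * \<Phi> x" if "x \<ge> 0" for x
    unfolding D_def using p c that by (intro complementary_pair_ge_powr[OF pair _ c \<Psi>]) auto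
  have \<Phi>1: "\<Phi> 1 \<le> 1" and \<Psi>1: "\<Psi> 1 \<le> 1"
    unfolding assms(9)[symmetric] by (simp_all add: add_increasing add_increasing2)
  define \<psi> where "\<psi> = enn2real (\<Psi> 1)"
  have \<psi>: "\<Psi> 1 = ennreal \<psi>" "\<psi> \<ge> 0"
    using order.strict_trans1[OF \<Psi>1] by (simp_all add: \<psi>_def)
  define C where "C = (if p = 1 then D else 4 * (p + 1) / (p - 1) * (2 * D) powr (p - 1) * D)"
  have C: "C \<ge> 0" using p D by (simp add: C_def)
  \<comment> \<open>The first entry brings F/r below 1, for the case \<open>\<Psi>\<close>(1) = 0;
    the second makes the weighted sum at most \<open>\<Psi>\<close>(1). If \<open>\<psi>\<close> is
    0, the second entry is 0 by the division convention.\<close>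
  define r where "r = max (1 + D) (c * C / \<psi>)"
  have r: "r \<ge> 1" "r \<ge> 1 + D" "r \<ge> c * C / \<psi>" using D by (auto simp: r_def)
  \<comment> \<open>Continuity of \<open>\<Phi>\<close> is known on [0, \<infinity>) only, so the
    argument is first viewed as a map into that restricted Borel space.\<close>
  have \<Phi>_meas: "(\<lambda>x. \<Phi> (norm (f x) / s)) \<in> borel_measurable \<mu>" if "f \<in> borel_measurable \<mu>" "s > 0" for f :: "'g set \<Rightarrow> complex" and s
  proof -
    have "(\<lambda>x. norm (f x) / s) \<in> \<mu> \<rightarrow>\<^sub>M restrict_space borel {0..}"
      using that by (intro measurable_restrict_space2) auto
    from measurable_compose[OF this borel_measurable_continuous_on_restrict[OF assms(10)]] show ?thesis .
  qed
  \<comment> \<open>Every scale s admissible for f gives a scale r s admissible on the dual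
    side.\<close>
  have main: "dual_orlicz_norm G K b \<Psi> (\<lambda>\<pi>. fourier_size G K haar f (b \<pi>)) \<le> ennreal (r * s)"
    if meas: "f \<in> borel_measurable \<mu>" and s: "s > 0" and fs: "(\<integral>\<^sup>+x. \<Phi> (norm (f x) / s) \<partial>\<mu>) \<le> \<Phi> 1" for f s
  proof -
    define f' where "f' x = f x / of_real s" for x
    have [measurable]: "f' \<in> borel_measurable \<mu>" using meas unfolding f'_def by measurable
    have meas': "(\<lambda>g. f' (g <#\<^bsub>G\<^esub> K)) \<in> borel_measurable haar" by measurable
    have bound: "(\<integral>\<^sup>+g. ennreal (cmod (f' (g <#\<^bsub>G\<^esub> K)) powr (1 + 1 / p)) \<partial>haar) \<le> ennreal D"
    proof -
      have "(\<integral>\<^sup>+g. ennreal (cmod (f' (g <#\<^bsub>G\<^esub> K)) powr (1 + 1 / p)) \<partial>haar) =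
          (\<integral>\<^sup>+x. ennreal (cmod (f' x) powr (1 + 1 / p)) \<partial>\<mu>)"
        by (rule transfer[symmetric]) measurable
      also have "\<dots> \<le> (\<integral>\<^sup>+x. ennreal D * \<Phi> (norm (f x) / s) \<partial>\<mu>)"
        using s by (intro nn_integral_mono order_trans[OF \<Phi>]) (auto simp: f'_def norm_divide)
      also have "\<dots> = ennreal D * (\<integral>\<^sup>+x. \<Phi> (norm (f x) / s) \<partial>\<mu>)"
        using \<Phi>_meas[OF meas s] by (rule nn_integral_cmult)
      also have "\<dots> \<le> ennreal D * 1"
        by (intro mult_left_mono order_trans[OF fs \<Phi>1]) simp
      finally show ?thesis by simp
    qed
    have int: "integrable haar (\<lambda>g. f' (g <#\<^bsub>G\<^esub> K))"
      and L1: "(\<integral>g. cmod (f' (g <#\<^bsub>G\<^esub> K)) \<partial>haar) \<le> 1 + D"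
      using L1_le_one_plus_powr[OF meas' bound] p D by auto
    let ?F = "\<lambda>\<pi>. fourier_size G K haar f' (b \<pi>)"
    let ?w = "\<lambda>\<pi>. fixed_dim K (b \<pi>) * fst (b \<pi>)"
    have F: "fourier_size G K haar f (b \<pi>) / (r * s) = ?F \<pi> / r \<and> ?F \<pi> \<le> 1 + D" if \<pi>: "\<pi> \<in> class_I_dual G K" for \<pi>
    proof -
      obtain d \<rho> where d: "b \<pi> = (d, \<rho>)" by fastforce
      have R: "unitary_rep G (d, \<rho>)"
        using unitary_irrepsD(1)[OF adapted_bases_irreps[OF b \<pi>]] d by simp
      have basis: "vectorspace.basis class_ring (fixed_space K (d, \<rho>)) (unit_vec d ` {..<fixed_dim K (d, \<rho>)})"
        using b \<pi> d unfolding adapted_bases_def by (metis fst_conv)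
      show ?thesis
        using fourier_size_scale[OF R s, of K f] order_trans[OF fourier_size_le_L1[OF K R basis int] L1] s r
        by (simp add: d f'_def[abs_def] field_simps)
    qed
    have "(\<Sum>\<pi>\<in>S. \<Psi> (fourier_size G K haar f (b \<pi>) / (r * s)) * of_nat (?w \<pi>)) \<le> \<Psi> 1"
      if S: "finite S" "S \<subseteq> class_I_dual G K" for S
    proof (cases "\<psi> = 0")
      case True
      have "\<Psi> (fourier_size G K haar f (b \<pi>) / (r * s)) = 0" if "\<pi> \<in> S" for \<pi>
      proof -
        have F': "fourier_size G K haar f (b \<pi>) / (r * s) = ?F \<pi> / r" "?F \<pi> \<le> 1 + D" using F S that by auto
        \<comment> \<open>Since F \<le> 1 + D \<le> r, monotonicity places the argument in [0, 1],
          where \<open>\<Psi>\<close> vanishes in this case.\<close>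
        have "\<Psi> (?F \<pi> / r) \<le> \<Psi> 1"
          using F'(2) r by (intro young_function_mono[OF Y]) (auto simp: fourier_size_nonneg)
        then show ?thesis using True \<psi>(1) F'(1) by simp
      qed
      then show ?thesis by simp
    next
      case False
      have "(\<Sum>\<pi>\<in>S. \<Psi> (fourier_size G K haar f (b \<pi>) / (r * s)) * of_nat (?w \<pi>)) \<le>
          (\<Sum>\<pi>\<in>S. ennreal (c / r powr (p + 1) * (real (?w \<pi>) * ?F \<pi> powr (p + 1))))"
      proof (rule sum_mono)
        fix \<pi> assume "\<pi> \<in> S"
        then have "fourier_size G K haar f (b \<pi>) / (r * s) = ?F \<pi> / r" using F S by blast
        moreover have "\<Psi> (?F \<pi> / r) \<le> ennreal (c * (?F \<pi> / r) powr (p + 1))"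
          using r by (intro \<Psi>) (simp add: fourier_size_nonneg)
        ultimately have "\<Psi> (fourier_size G K haar f (b \<pi>) / (r * s)) * of_nat (?w \<pi>) \<le>
            ennreal (c * (?F \<pi> / r) powr (p + 1)) * ennreal (real (?w \<pi>))"
          by (simp only: ennreal_of_nat_eq_real_of_nat) (rule mult_right_mono, simp_all)
        also have "\<dots> = ennreal (c * (?F \<pi> / r) powr (p + 1) * real (?w \<pi>))"
          using c by (intro ennreal_mult[symmetric]) auto
        also have "c * (?F \<pi> / r) powr (p + 1) * real (?w \<pi>) = c / r powr (p + 1) * (real (?w \<pi>) * ?F \<pi> powr (p + 1))"
          using r by (simp add: powr_divide fourier_size_nonneg)
        finally show "\<Psi> (fourier_size G K haar f (b \<pi>) / (r * s)) * of_nat (?w \<pi>) \<le>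
            ennreal (c / r powr (p + 1) * (real (?w \<pi>) * ?F \<pi> powr (p + 1)))" .
      qed
      also have "\<dots> = ennreal (c / r powr (p + 1) * (\<Sum>\<pi>\<in>S. real (?w \<pi>) * ?F \<pi> powr (p + 1)))"
        using c by (subst sum_ennreal) (auto simp: sum_distrib_left)
      also have "\<dots> \<le> ennreal \<psi>"
      proof (rule ennreal_leI)
        have "(\<Sum>\<pi>\<in>S. real (?w \<pi>) * ?F \<pi> powr (p + 1)) \<le> C"
          using hausdorff_young[OF K b p D meas' bound S] by (simp add: C_def)
        then have "c / r powr (p + 1) * (\<Sum>\<pi>\<in>S. real (?w \<pi>) * ?F \<pi> powr (p + 1)) \<le> c / r powr (p + 1) * C"
          using c by (intro mult_left_mono) auto
        \<comment> \<open>As r \<ge> 1, one power of r is enough, so r may be chosen linearly in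
          C.\<close>
        also have "\<dots> \<le> c / r powr 1 * C"
          using c C r p by (intro mult_right_mono divide_left_mono powr_mono) auto
        also have "\<dots> \<le> \<psi>"
          using r c False \<psi>(2) by (simp add: field_simps)
        finally show "c / r powr (p + 1) * (\<Sum>\<pi>\<in>S. real (?w \<pi>) * ?F \<pi> powr (p + 1)) \<le> \<psi>" .
      qed
      finally show ?thesis by (simp add: \<psi>(1))
    qed
    \<comment> \<open>An infinite sum of nonnegative extended reals is bounded once all its finite
      partial sums are.\<close>
    then have "(\<Sum>\<^sub>\<infinity>\<pi>\<in>class_I_dual G K. \<Psi> (fourier_size G K haar f (b \<pi>) / (r * s)) * of_nat (?w \<pi>)) \<le> \<Psi> 1"
      by (intro infsum_le_finite_sums nonneg_summable_on_complete) auto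
    then show ?thesis
      unfolding dual_orlicz_norm_def using r s by (intro INF_lower) auto
  qed
  show ?thesis
  proof (intro exI[where x = r] conjI ballI)
    fix f assume f: "f \<in> orlicz_space \<Phi> \<mu>"
    let ?N = "dual_orlicz_norm G K b \<Psi> (\<lambda>\<pi>. fourier_size G K haar f (b \<pi>))"
    \<comment> \<open>Dividing by r first turns the claim into a lower bound for the infimum
      defining the norm of f; this also covers an empty set of admissible scales.\<close>
    have "?N / ennreal r \<le> orlicz_norm \<Phi> \<mu> f"
      unfolding orlicz_norm_def
    proof (rule INF_greatest)
      fix s assume "s \<in> {s. 0 < s \<and> (\<integral>\<^sup>+x. \<Phi> (norm (f x) / s) \<partial>\<mu>) \<le> \<Phi> 1}"
      then have "?N \<le> ennreal (r * s)" using f by (intro main) (auto simp: orlicz_space_def)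
      then show "?N / ennreal r \<le> ennreal s"
        using r by (intro divide_le_posI_ennreal) (auto simp: ennreal_mult')
    qed
    then have "ennreal r * (?N / ennreal r) \<le> ennreal r * orlicz_norm \<Phi> \<mu> f"
      by (rule mult_left_mono) simp
    also have "ennreal r * (?N / ennreal r) = ?N"
      using r by (simp add: ennreal_times_divide mult.commute[of "ennreal r"] ennreal_mult_divide_eq)
    finally show "?N \<le> ennreal r * orlicz_norm \<Phi> \<mu> f" .
  qed (use r in simp)
qed

end
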